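(* Let $\nu>0$ be a constant, let $\Omega=(0,1)\subset\mathbb{R}$, and let $H:\overline\Omega\times\mathbb{R}\to\mathbb{R}$ be given by $H(x,p)=\sup_{\alpha\in[-1,1]}\{x\alpha p\}=x|p|$. Let $F\equiv 0$ on $\mathcal{X}=L^2(\Omega)$ and $G\equiv 1\in L^2(\Omega)\subset H^{-1}(\Omega)$. Then there exist $m\in H_0^1(\Omega)$, a sequence $\{\lambda_j\}_{j\in\mathbb{N}}\subset(0,1]$ with $\lambda_j\to0$ as $j\to\infty$, an admissible family of regularized Hamiltonians $\{H_{\lambda_j}\}_{j\in\mathbb{N}}$ for $H$, and, for each $j$, a weak solution $(u_{\lambda_j},m_{\lambda_j})\in H_0^1(\Omega)\times H_0^1(\Omega)$ of the regularized problem with Hamiltonian $H_{\lambda_j}$, such that: (1) $(0,m)\in H_0^1(\Omega)\times H_0^1(\Omega)$ is a weak solution of the MFG partial differential inclusion, and $m\ne 0$ in $H_0^1(\Omega)$; (2) $m_{\lambda_j}\rightharpoonup m$ weakly in $H_0^1(\Omega)$ as $j\to\infty$, and $$\lim_{j\to\infty}\|m_{\lambda_j}-m\|_{H^1(\Omega)}>0.$$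
   Context: Here $\Omega=(0,1)$, $d=1$, $F\equiv0$, $G\equiv1$. The subdifferential is $\partial_pH(x,p):=\{\tilde b\in\mathbb{R}: H(x,q)\ge H(x,p)+\tilde b(q-p)\ \forall q\in\mathbb{R}\}$, and for $v\in W^{1,1}(\Omega)$, $D_pH[v]:=\{\tilde b\in L^\infty(\Omega):\tilde b(x)\in\partial_pH(x,\partial_xv(x))\text{ for a.e. }x\in\Omega\}$. Weak solution of the MFG partial differential inclusion: a pair $(u,m)\in H_0^1(\Omega)\times H_0^1(\Omega)$ for which there exists $\tilde b_*\in D_pH[u]$ such that $\int_\Omega \nu\,\partial_xu\,\partial_x\psi+H(x,\partial_xu)\psi\,dx=0$ for all $\psi\in H_0^1(\Omega)$, and $\int_\Omega \nu\,\partial_xm\,\partial_x\phi+m\tilde b_*\,\partial_x\phi\,dx=\int_\Omega\phi\,dx$ for all $\phi\in H_0^1(\Omega)$. Admissible family of regularized Hamiltonians $\{H_{\lambda_j}\}_{j\in\mathbb{N}}$: real-valued functions on $\overline\Omega\times\mathbb{R}$ for which there are a continuous $\omega:[0,1]\to[0,\infty)$ with $\omega(0)=0$ and a constant $L_H$ that is a Lipschitz constant of $p\mapsto H(x,p)$ for every $x\in\overline\Omega$, such that, for each $j$: $H_{\lambda_j}$ is continuous on $\overline\Omega\times\mathbb{R}$ and $|H_{\lambda_j}(x,p)-H_{\lambda_j}(x,q)|\le L_H|p-q|$ for all $x\in\overline\Omega$, $p,q\in\mathbb{R}$; $p\mapsto H_{\lambda_j}(x,p)$ is convex for each $x\in\overline\Omega$;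 the partial derivative $\frac{\partial H_{\lambda_j}}{\partial p}:\overline\Omega\times\mathbb{R}\to\mathbb{R}$ exists and is continuous; and $|H_{\lambda_j}(x,p)-H(x,p)|\le\omega(\lambda_j)$ for all $(x,p)\in\overline\Omega\times\mathbb{R}$. Weak solution of the regularized problem with Hamiltonian $H_\lambda$: a pair $(u_\lambda,m_\lambda)\in H_0^1(\Omega)\times H_0^1(\Omega)$ such that $\int_\Omega \nu\,\partial_xu_\lambda\,\partial_x\psi+H_\lambda(x,\partial_xu_\lambda)\psi\,dx=0$ for all $\psi\in H_0^1(\Omega)$, and $\int_\Omega \nu\,\partial_xm_\lambda\,\partial_x\phi+m_\lambda\frac{\partial H_\lambda}{\partial p}(x,\partial_xu_\lambda)\,\partial_x\phi\,dx=\int_\Omega\phi\,dx$ for all $\phi\in H_0^1(\Omega)$. *)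

theory Defs
  imports "HOL-Analysis.Analysis"
begin

abbreviation Omega :: "real set" where
  "Omega \<equiv> {0<..<1}"

abbreviation lebesgue_Omega :: "real measure" where
  "lebesgue_Omega \<equiv> lebesgue_on Omega"

text \<open>
  Elements of the function spaces are represented by functions on the whole real line; only
  their values almost everywhere on \<open>Omega\<close> matter. Identities
  between elements are stated almost everywhere.
\<close>

definition L2 :: "(real \<Rightarrow> real) set" where
  "L2 = {f \<in> borel_measurable lebesgue_Omega. integrable lebesgue_Omega (\<lambda>x. (f x)\<^sup>2)}"

definition Linfty :: "(real \<Rightarrow> real) set" where
  "Linfty = {f \<in> borel_measurable lebesgue_Omega. \<exists>C. AE x in lebesgue_Omega. \<bar>f x\<bar> \<le> C}"

definition L1_loc :: "(real \<Rightarrow> real) set" where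
  "L1_loc = {f. \<forall>K. compact K \<and> K \<subseteq> Omega \<longrightarrow> f absolutely_integrable_on K}"

definition test_functions :: "(real \<Rightarrow> real) set" where
  "test_functions = {\<phi>. (\<forall>k x. ((deriv ^^ k) \<phi>) field_differentiable (at x)) \<and>
     compact (closure {x. \<phi> x \<noteq> 0}) \<and> closure {x. \<phi> x \<noteq> 0} \<subseteq> Omega}"

definition has_weak_deriv :: "(real \<Rightarrow> real) \<Rightarrow> (real \<Rightarrow> real) \<Rightarrow> bool" where
  "has_weak_deriv v g \<longleftrightarrow> v \<in> L1_loc \<and> g \<in> L1_loc \<and>
     (\<forall>\<phi>\<in>test_functions.
        (LINT x|lebesgue_Omega. v x * deriv \<phi> x) = - (LINT x|lebesgue_Omega. g x * \<phi> x))"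

text \<open>A representative of the weak derivative, which is unique up to null sets.\<close>

definition weak_deriv :: "(real \<Rightarrow> real) \<Rightarrow> real \<Rightarrow> real" where
  "weak_deriv v = (SOME g. has_weak_deriv v g)"

definition H1 :: "(real \<Rightarrow> real) set" where
  "H1 = {v \<in> L2. \<exists>g\<in>L2. has_weak_deriv v g}"

definition H1_norm :: "(real \<Rightarrow> real) \<Rightarrow> real" where
  "H1_norm v = sqrt ((LINT x|lebesgue_Omega. (v x)\<^sup>2) + (LINT x|lebesgue_Omega. (weak_deriv v x)\<^sup>2))"

definition H10 :: "(real \<Rightarrow> real) set" where
  "H10 = {v \<in> H1. \<exists>\<phi>. (\<forall>n::nat. \<phi> n \<in> test_functions) \<and>
     (\<lambda>n. H1_norm (\<lambda>x. v x - \<phi> n x)) \<longlonglongrightarrow> 0}"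

text \<open>
  A bounded linear functional on \<^const>\<open>H10\<close>; linearity and boundedness together force it to
  agree on functions that are equal almost everywhere.
\<close>

definition bounded_functional_H10 :: "((real \<Rightarrow> real) \<Rightarrow> real) \<Rightarrow> bool" where
  "bounded_functional_H10 l \<longleftrightarrow>
     (\<forall>v\<in>H10. \<forall>w\<in>H10. l (\<lambda>x. v x + w x) = l v + l w) \<and>
     (\<forall>c. \<forall>v\<in>H10. l (\<lambda>x. c * v x) = c * l v) \<and>
     (\<exists>C. \<forall>v\<in>H10. \<bar>l v\<bar> \<le> C * H1_norm v)"

definition weakly_converges_H10 :: "(nat \<Rightarrow> real \<Rightarrow> real) \<Rightarrow> (real \<Rightarrow> real) \<Rightarrow> bool" where
  "weakly_converges_H10 w v \<longleftrightarrow>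
     (\<forall>l. bounded_functional_H10 l \<longrightarrow> (\<lambda>j. l (w j)) \<longlonglongrightarrow> l v)"

text \<open>The embedding of \<^const>\<open>L2\<close> into the dual of \<^const>\<open>H10\<close>.\<close>

definition L2_functional :: "(real \<Rightarrow> real) \<Rightarrow> (real \<Rightarrow> real) \<Rightarrow> real" where
  "L2_functional g \<phi> = (LINT x|lebesgue_Omega. g x * \<phi> x)"

text \<open>Hamiltonians are used only for \<open>x \<in> {0..1}\<close>, the closure of the domain.\<close>

definition mfg_H :: "real \<Rightarrow> real \<Rightarrow> real" where
  "mfg_H x p = (SUP \<alpha>\<in>{-1..1}. x * \<alpha> * p)"

lemma mfg_H_eq:
  assumes "0 \<le> x"
  shows "mfg_H x p = x * \<bar>p\<bar>"
  unfolding mfg_H_def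
proof (rule cSup_eq_maximum)
  have "x * \<bar>p\<bar> = x * (if 0 \<le> p then 1 else -1) * p" by auto
  then show "x * \<bar>p\<bar> \<in> (\<lambda>\<alpha>. x * \<alpha> * p) ` {-1..1}" by (rule image_eqI) auto
next
  fix y assume "y \<in> (\<lambda>\<alpha>. x * \<alpha> * p) ` {-1..1}"
  then obtain \<alpha> where "\<alpha> \<in> {-1..1}" and "y = x * \<alpha> * p" by blast
  then have a: "\<bar>\<alpha>\<bar> \<le> 1" and y: "y = x * (\<alpha> * p)" by (auto simp: mult.assoc)
  have "\<alpha> * p \<le> \<bar>\<alpha>\<bar> * \<bar>p\<bar>" by (metis abs_ge_self abs_mult)
  also have "\<dots> \<le> 1 * \<bar>p\<bar>" by (rule mult_right_mono[OF a]) simp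
  finally show "y \<le> x * \<bar>p\<bar>" unfolding y by (simp add: mult_left_mono assms)
qed

definition subdiff_p :: "(real \<Rightarrow> real \<Rightarrow> real) \<Rightarrow> real \<Rightarrow> real \<Rightarrow> real set" where
  "subdiff_p H x p = {b. \<forall>q. H x q \<ge> H x p + b * (q - p)}"

definition DpH :: "(real \<Rightarrow> real \<Rightarrow> real) \<Rightarrow> (real \<Rightarrow> real) \<Rightarrow> (real \<Rightarrow> real) set" where
  "DpH H v = {b \<in> Linfty. AE x in lebesgue_Omega. b x \<in> subdiff_p H x (weak_deriv v x)}"

definition admissible_family ::
    "(real \<Rightarrow> real \<Rightarrow> real) \<Rightarrow> (nat \<Rightarrow> real) \<Rightarrow> (nat \<Rightarrow> real \<Rightarrow> real \<Rightarrow> real) \<Rightarrow> bool" where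
  "admissible_family H lam Hreg \<longleftrightarrow>
     (\<exists>\<omega> L. continuous_on {0..1} \<omega> \<and> (\<forall>t\<in>{0..1}. 0 \<le> \<omega> t) \<and> \<omega> 0 = 0 \<and>
       (\<forall>x\<in>{0..1}. L-lipschitz_on UNIV (H x)) \<and>
       (\<forall>j.
         continuous_on ({0..1} \<times> UNIV) (\<lambda>(x, p). Hreg j x p) \<and>
         (\<forall>x\<in>{0..1}. L-lipschitz_on UNIV (Hreg j x)) \<and>
         (\<forall>x\<in>{0..1}. convex_on UNIV (Hreg j x)) \<and>
         (\<forall>x\<in>{0..1}. \<forall>p. Hreg j x field_differentiable (at p)) \<and>
         continuous_on ({0..1} \<times> UNIV) (\<lambda>(x, p). deriv (Hreg j x) p) \<and>
         (\<forall>x\<in>{0..1}. \<forall>p. \<bar>Hreg j x p - H x p\<bar> \<le> \<omega> (lam j))))"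

text \<open>Right-hand sides are given as functionals on \<^const>\<open>H10\<close>.\<close>

definition weak_HJB ::
    "real \<Rightarrow> (real \<Rightarrow> real \<Rightarrow> real) \<Rightarrow> ((real \<Rightarrow> real) \<Rightarrow> real) \<Rightarrow> (real \<Rightarrow> real) \<Rightarrow> bool" where
  "weak_HJB \<nu> H f u \<longleftrightarrow> (\<forall>\<psi>\<in>H10.
     (LINT x|lebesgue_Omega.
        \<nu> * weak_deriv u x * weak_deriv \<psi> x + H x (weak_deriv u x) * \<psi> x) = f \<psi>)"

definition weak_KFP ::
    "real \<Rightarrow> (real \<Rightarrow> real) \<Rightarrow> ((real \<Rightarrow> real) \<Rightarrow> real) \<Rightarrow> (real \<Rightarrow> real) \<Rightarrow> bool" where
  "weak_KFP \<nu> b g m \<longleftrightarrow> (\<forall>\<phi>\<in>H10.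
     (LINT x|lebesgue_Omega.
        \<nu> * weak_deriv m x * weak_deriv \<phi> x + m x * b x * weak_deriv \<phi> x) = g \<phi>)"

definition weak_solution_PDI ::
    "real \<Rightarrow> (real \<Rightarrow> real \<Rightarrow> real) \<Rightarrow> ((real \<Rightarrow> real) \<Rightarrow> (real \<Rightarrow> real) \<Rightarrow> real) \<Rightarrow>
     ((real \<Rightarrow> real) \<Rightarrow> real) \<Rightarrow> (real \<Rightarrow> real) \<Rightarrow> (real \<Rightarrow> real) \<Rightarrow> bool" where
  "weak_solution_PDI \<nu> H F G u m \<longleftrightarrow> u \<in> H10 \<and> m \<in> H10 \<and>
     (\<exists>b\<in>DpH H u. weak_HJB \<nu> H (F m) u \<and> weak_KFP \<nu> b G m)"

definition weak_solution_regularized ::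
    "real \<Rightarrow> (real \<Rightarrow> real \<Rightarrow> real) \<Rightarrow> ((real \<Rightarrow> real) \<Rightarrow> (real \<Rightarrow> real) \<Rightarrow> real) \<Rightarrow>
     ((real \<Rightarrow> real) \<Rightarrow> real) \<Rightarrow> (real \<Rightarrow> real) \<Rightarrow> (real \<Rightarrow> real) \<Rightarrow> bool" where
  "weak_solution_regularized \<nu> H F G u m \<longleftrightarrow> u \<in> H10 \<and> m \<in> H10 \<and>
     weak_HJB \<nu> H (F m) u \<and> weak_KFP \<nu> (\<lambda>x. deriv (H x) (weak_deriv u x)) G m"

end

theory Submission
  imports Defs "HOL-Real_Asymp.Real_Asymp"
begin

text \<open>
  Zero drift and \<open>u = 0\<close> give the density \<open>m x = x (1 - x) / (2 \<nu>)\<close>. Perturb it to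
  \<open>\<mu> j = m + w j\<close>, where \<open>w j\<close> is a small bump times \<open>sin (n x) / n\<close> with \<open>n = j + 1\<close>: it tends to
  \<open>0\<close> uniformly and weakly in \<open>H10\<close>, but its norm does not. Since \<open>\<mu> j\<close> stays positive where \<open>w j\<close>
  lives, the drift \<open>b j = - \<nu> (w j)' / \<mu> j\<close> preserves the flux, \<open>\<nu> (\<mu> j)' + b j \<mu> j = \<nu> m'\<close>, so that
  \<open>\<mu> j\<close> solves the Fokker-Planck equation with drift \<open>b j\<close>, and \<open>\<bar>b j x\<bar> < x\<close> for \<open>0 < x\<close>. As \<open>b j x\<close>
  is then an interior point of the subdifferential of \<open>x \<bar>p\<bar>\<close> at \<open>p = 0\<close>, the kink can be smoothed
  to any prescribed slope \<open>b j x\<close>, and with this Hamiltonian \<open>u = 0\<close> still solves the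
  Hamilton-Jacobi-Bellman equation.
\<close>

section \<open>Smooth functions and test functions\<close>

text \<open>With \<open>u = 0\<close> the first equation does not see the drift, which may take any
  value in \<open>[-x, x]\<close>. Two degeneracies at the boundary shape \<open>w j\<close>:
  \<open>m\<close> vanishes at both ends, and the interval \<open>[-x, x]\<close> shrinks to a point
  at \<open>x = 0\<close>. The bump therefore stays in \<open>{1/4..3/4}\<close>, where
  \<open>x\<close> and \<open>m x\<close> are bounded below, and its amplitude depends on
  \<open>\<nu>\<close> alone, so that it need not decay with \<open>j\<close>.

  Three notions of the statement need care. \<open>weak_deriv\<close> chooses a representative, so
  even for a polynomial the use of the classical derivative rests on uniqueness of weak derivatives,
  hence on the fundamental lemma of the calculus of variations. \<open>H10\<close> is a closure of
  the test functions, so \<open>m\<close>, whose support reaches the boundary, has to be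
  approximated explicitly. Weak convergence is tested against all bounded functionals; an argument
  in the spirit of Banach and Saks treats them through norms of sums alone, without representing
  them by inner products.\<close>

definition smooth :: "(real \<Rightarrow> real) \<Rightarrow> bool" where
  "smooth f \<longleftrightarrow> (\<forall>k x. ((deriv ^^ k) f) field_differentiable (at x))"

text \<open>A set closed under differentiation contains all iterated derivatives of its members, so
  no formula for the \<open>k\<close>-th derivative is needed.\<close>

lemma smooth_coinduct:
  assumes "f \<in> S" and S: "\<And>g. g \<in> S \<Longrightarrow> \<exists>g'\<in>S. \<forall>x. (g has_field_derivative g' x) (at x)"
  shows "smooth f"
proof -
  have "(deriv ^^ k) f \<in> S" for k
  proof (induction k)
    case (Suc k)
    obtain g' where "g' \<in> S" "\<forall>x. ((deriv ^^ k) f has_field_derivative g' x) (at x)"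
      using S[OF Suc] by blast
    then have "deriv ((deriv ^^ k) f) = g'" by (intro ext DERIV_imp_deriv) blast
    then show ?case using \<open>g' \<in> S\<close> by simp
  qed (use \<open>f \<in> S\<close> in simp)
  then show ?thesis
    unfolding smooth_def using S field_differentiable_def by blast
qed

lemma smooth_DERIV: "smooth f \<Longrightarrow> (f has_field_derivative deriv f x) (at x)"
  unfolding smooth_def by (metis DERIV_deriv_iff_field_differentiable funpow_0)

lemma smooth_deriv: "smooth f \<Longrightarrow> smooth (deriv f)"
  unfolding smooth_def by (metis comp_apply funpow_Suc_right)

lemma smooth_continuous: "smooth f \<Longrightarrow> continuous_on A f"
  by (meson DERIV_isCont continuous_at_imp_continuous_on smooth_DERIV)

text \<open>The functions \<open>P (1/x) exp (-1/x)\<close>, extended by zero, are closed under differentiation.\<close>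

definition flat :: "real poly \<Rightarrow> real \<Rightarrow> real" where
  "flat P x = (if x > 0 then poly P (1 / x) * exp (- 1 / x) else 0)"

text \<open>This is the difference quotient of \<open>flat P\<close> at the origin. Substituting
  \<open>y = 1 / x\<close> turns it into a polynomial divided by \<open>exp y\<close> at
  infinity.\<close>

lemma flat_quotient_tendsto_0: "((\<lambda>x. flat P x / x) \<longlongrightarrow> 0) (at 0)"
proof -
  have "((\<lambda>y. \<Sum>i\<le>degree P. coeff P i * (y ^ Suc i / exp y)) \<longlongrightarrow> (\<Sum>i\<le>degree P. coeff P i * 0)) at_top"
    by (intro tendsto_intros tendsto_power_div_exp_0)
  then have "((\<lambda>y. poly P y * y / exp y) \<longlongrightarrow> 0) at_top"
    by (simp add: poly_altdef sum_distrib_left sum_divide_distrib mult_ac)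
  then have "((\<lambda>x. poly P (inverse x) * inverse x / exp (inverse x)) \<longlongrightarrow> 0) (at_right 0)"
    by (rule filterlim_compose) (rule filterlim_inverse_at_top_right)
  then have "((\<lambda>x. flat P x / x) \<longlongrightarrow> 0) (at_right 0)"
    by (rule Lim_transform_eventually)
      (auto simp: eventually_at_filter flat_def exp_minus field_simps)
  moreover have "((\<lambda>x. flat P x / x) \<longlongrightarrow> 0) (at_left 0)"
    by (rule tendsto_eventually) (auto simp: eventually_at_filter flat_def)
  ultimately show ?thesis by (simp add: filterlim_split_at)
qed

text \<open>The derivative of \<open>y = 1 / x\<close> is \<open>- y\<^sup>2\<close>, so away from
  the origin the chain rule turns \<open>P\<close> into \<open>y\<^sup>2 * (P - P')\<close>; the
  factor \<open>[:0, 0, 1:]\<close> is this square.\<close>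

lemma DERIV_flat: "(flat P has_field_derivative flat ([:0, 0, 1:] * (P - pderiv P)) x) (at x)"
proof (cases x "0::real" rule: linorder_cases)
  case less
  have "((\<lambda>x. 0) has_field_derivative flat ([:0, 0, 1:] * (P - pderiv P)) x) (at x)"
    using less by (simp add: flat_def)
  then show ?thesis
    by (rule has_field_derivative_transform_within_open[of _ _ _ "{..<0}"])
      (use less in \<open>auto simp: flat_def\<close>)
next
  case equal
  then show ?thesis
    using flat_quotient_tendsto_0[of P] by (simp add: has_field_derivative_iff flat_def)
next
  case greater
  have "((\<lambda>x. poly P (1 / x) * exp (- 1 / x)) has_field_derivative flat ([:0, 0, 1:] * (P - pderiv P)) x) (at x)"
    using greater by (auto intro!: derivative_eq_intros DERIV_chain'[OF _ poly_DERIV]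
        simp: flat_def field_simps power2_eq_square)
  then show ?thesis
    by (rule has_field_derivative_transform_within_open[of _ _ _ "{0<..}"])
      (use greater in \<open>auto simp: flat_def\<close>)
qed

text \<open>A candidate set for \<open>smooth_coinduct\<close>: the product rule leads to sums of
  products, so closure under both is built in and only the generators have to be differentiated by
  hand.\<close>

inductive_set smooth_closure :: "(real \<Rightarrow> real) set \<Rightarrow> (real \<Rightarrow> real) set" for B where
  smooth: "smooth f \<Longrightarrow> f \<in> smooth_closure B"
| base: "f \<in> B \<Longrightarrow> f \<in> smooth_closure B"
| add: "f \<in> smooth_closure B \<Longrightarrow> g \<in> smooth_closure B \<Longrightarrow> (\<lambda>x. f x + g x) \<in> smooth_closure B"
| mult: "f \<in> smooth_closure B \<Longrightarrow> g \<in> smooth_closure B \<Longrightarrow> (\<lambda>x. f x * g x) \<in> smooth_closure B"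

lemma smooth_closure:
  assumes "f \<in> smooth_closure B"
    and B: "\<And>g. g \<in> B \<Longrightarrow> \<exists>g'\<in>smooth_closure B. \<forall>x. (g has_field_derivative g' x) (at x)"
  shows "smooth f"
proof (rule smooth_coinduct[OF assms(1)])
  fix g assume "g \<in> smooth_closure B"
  then show "\<exists>g'\<in>smooth_closure B. \<forall>x. (g has_field_derivative g' x) (at x)"
  proof induction
    case (smooth f)
    then show ?case using smooth_DERIV smooth_deriv smooth_closure.smooth by blast
  next
    case (base f)
    then show ?case by (rule B)
  next
    case (add f g)
    then obtain f' g' where "f' \<in> smooth_closure B" "g' \<in> smooth_closure B"
      "\<forall>x. (f has_field_derivative f' x) (at x)" "\<forall>x. (g has_field_derivative g' x) (at x)" by blast
    then show ?case
      by (intro bexI[of _ "\<lambda>x. f' x + g' x"]) (auto intro: DERIV_add smooth_closure.add)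
  next
    case (mult f g)
    then obtain f' g' where "f' \<in> smooth_closure B" "g' \<in> smooth_closure B"
      "\<forall>x. (f has_field_derivative f' x) (at x)" "\<forall>x. (g has_field_derivative g' x) (at x)" by blast
    then show ?case
      using mult.hyps by (intro bexI[of _ "\<lambda>x. f' x * g x + g' x * f x"])
        (auto intro: DERIV_mult' smooth_closure.add smooth_closure.mult DERIV_mult)
  qed
qed

lemma smooth_add: "smooth f \<Longrightarrow> smooth g \<Longrightarrow> smooth (\<lambda>x. f x + g x)"
  by (rule smooth_closure[of _ "{}"]) (auto intro: smooth_closure.intros)

lemma smooth_mult: "smooth f \<Longrightarrow> smooth g \<Longrightarrow> smooth (\<lambda>x. f x * g x)"
  by (rule smooth_closure[of _ "{}"]) (auto intro: smooth_closure.intros)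

lemma smooth_const: "smooth (\<lambda>x. c)"
  by (rule smooth_coinduct[of _ "range (\<lambda>c x. c)"]) (auto intro!: exI[of _ 0])

lemma smooth_id: "smooth (\<lambda>x. x)"
  by (rule smooth_coinduct[of _ "insert (\<lambda>x. x) (range (\<lambda>c x. c))"])
    (auto intro: exI[of _ 0] exI[of _ 1])

text \<open>The outer functions range over a family closed under differentiation, since the derivative
  of \<open>h \<circ> f\<close> involves \<open>h' \<circ> f\<close>.\<close>

lemma smooth_compose:
  assumes "smooth h" and "smooth f"
  shows "smooth (\<lambda>x. h (f x))"
proof (rule smooth_closure[of _ "{\<lambda>x. h (f x) |h. smooth h}"])
  fix g assume "g \<in> {\<lambda>x. h (f x) |h. smooth h}"
  then obtain h where h: "smooth h" "g = (\<lambda>x. h (f x))" by blast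
  have "(g has_field_derivative deriv h (f x) * deriv f x) (at x)" for x
    unfolding h(2) using h(1) assms(2) by (intro DERIV_chain2 smooth_DERIV)
  moreover have "(\<lambda>x. deriv h (f x) * deriv f x) \<in> smooth_closure {\<lambda>x. h (f x) |h. smooth h}"
    using h(1) assms(2) by (intro smooth_closure.mult)
      (auto intro: smooth_closure.base smooth_closure.smooth smooth_deriv)
  ultimately show "\<exists>g'\<in>smooth_closure {\<lambda>x. h (f x) |h. smooth h}. \<forall>x. (g has_field_derivative g' x) (at x)"
    by (intro bexI allI)
qed (use assms(1) in \<open>auto intro: smooth_closure.base\<close>)

lemma smooth_exp: "smooth exp"
  by (rule smooth_coinduct[of _ "{exp}"]) auto

lemma smooth_sin: "smooth sin"
  by (rule smooth_coinduct[of _ "{sin, cos, \<lambda>x. - sin x, \<lambda>x. - cos x}"])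
    (auto intro!: exI derivative_eq_intros)

lemma smooth_flat: "smooth (flat P)"
  by (rule smooth_coinduct[of _ "range flat"]) (use DERIV_flat in auto)

lemmas smooth_intros = smooth_add smooth_mult smooth_const smooth_id
  smooth_compose[OF smooth_exp] smooth_compose[OF smooth_sin] smooth_compose[OF smooth_flat]

section \<open>Test functions and their supports\<close>

lemma test_functionI:
  assumes "smooth \<phi>" "0 < a" "b < 1" "\<And>x. \<phi> x \<noteq> 0 \<Longrightarrow> x \<in> {a..b}"
  shows "\<phi> \<in> test_functions"
proof -
  have "closure {x. \<phi> x \<noteq> 0} \<subseteq> {a..b}"
    using assms(4) by (intro closure_minimal) auto
  moreover from this have "compact (closure {x. \<phi> x \<noteq> 0})"
    by (meson bounded_closed_interval bounded_subset closed_closure compact_eq_bounded_closed)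
  ultimately show ?thesis
    using assms(1-3) unfolding test_functions_def smooth_def by fastforce
qed

lemma test_function_smooth: "\<phi> \<in> test_functions \<Longrightarrow> smooth \<phi>"
  by (simp add: test_functions_def smooth_def)

lemma test_functionE:
  assumes "\<phi> \<in> test_functions"
  obtains a b where "0 < a" "a < b" "b < 1" "\<And>x. \<phi> x \<noteq> 0 \<Longrightarrow> x \<in> {a..b}"
proof -
  \<comment> \<open>The point 1/2 keeps the compact set nonempty even for the zero function, so that
    its extrema exist.\<close>
  let ?K = "insert (1/2) (closure {x. \<phi> x \<noteq> 0})"
  have K: "compact ?K" "?K \<subseteq> Omega"
    using assms by (auto simp: test_functions_def)
  obtain a where a: "a \<in> ?K" "\<And>x. x \<in> ?K \<Longrightarrow> a \<le> x"
    using compact_attains_inf[OF K(1)] by blast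
  obtain b where b: "b \<in> ?K" "\<And>x. x \<in> ?K \<Longrightarrow> x \<le> b"
    using compact_attains_sup[OF K(1)] by blast
  have ab: "0 < a" "b < 1" using K(2) a(1) b(1) by auto
  show ?thesis
  \<comment> \<open>Halving \<open>a\<close> makes the inequality strict even if \<open>?K\<close>
    is a single point.\<close>
  proof (rule that[of "a/2" b])
    show "a / 2 < b" using a(2)[of b] b(1) ab by simp
    fix x assume "\<phi> x \<noteq> 0"
    then have "x \<in> ?K" using closure_subset[of "{x. \<phi> x \<noteq> 0}"] by blast
    then show "x \<in> {a/2..b}" using a(2)[of x] b(2)[of x] ab by auto
  qed (use ab in auto)
qed

lemma deriv_eq_0_outside:
  assumes "\<And>x. \<phi> x \<noteq> 0 \<Longrightarrow> x \<in> {a..b::real}" "x \<notin> {a..b}"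
  shows "deriv \<phi> x = (0::real)"
proof (rule DERIV_imp_deriv)
  show "(\<phi> has_field_derivative 0) (at x)"
    by (rule has_field_derivative_transform_within_open[of "\<lambda>_. 0" _ _ "- {a..b}"])
      (use assms in auto)
qed

lemma test_function_deriv:
  assumes "\<phi> \<in> test_functions"
  shows "deriv \<phi> \<in> test_functions"
proof -
  obtain a b where ab: "0 < a" "b < 1" "\<And>x. \<phi> x \<noteq> 0 \<Longrightarrow> x \<in> {a..b}"
    using test_functionE[OF assms] by metis
  show ?thesis
  proof (rule test_functionI[OF _ ab(1,2)])
    show "smooth (deriv \<phi>)" using assms by (intro smooth_deriv test_function_smooth)
    show "x \<in> {a..b}" if "deriv \<phi> x \<noteq> 0" for x
      using deriv_eq_0_outside[of \<phi> a b x] ab(3) that by blast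
  qed
qed

lemma test_function_add:
  assumes "\<phi> \<in> test_functions" "\<psi> \<in> test_functions"
  shows "(\<lambda>x. \<phi> x + \<psi> x) \<in> test_functions"
proof -
  obtain a b where ab: "0 < a" "b < 1" "\<And>x. \<phi> x \<noteq> 0 \<Longrightarrow> x \<in> {a..b}"
    using test_functionE[OF assms(1)] by metis
  obtain c d where cd: "0 < c" "d < 1" "\<And>x. \<psi> x \<noteq> 0 \<Longrightarrow> x \<in> {c..d}"
    using test_functionE[OF assms(2)] by metis
  show ?thesis
  proof (rule test_functionI[of _ "min a c" "max b d"])
    show "smooth (\<lambda>x. \<phi> x + \<psi> x)" by (intro smooth_add test_function_smooth assms)
    fix x assume "\<phi> x + \<psi> x \<noteq> 0"
    then have "x \<in> {a..b} \<or> x \<in> {c..d}" using ab(3) cd(3) by force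
    then show "x \<in> {min a c..max b d}" by auto
  qed (use ab cd in auto)
qed

lemma test_function_mult:
  assumes "smooth f" "\<phi> \<in> test_functions"
  shows "(\<lambda>x. f x * \<phi> x) \<in> test_functions"
proof -
  obtain a b where ab: "0 < a" "b < 1" "\<And>x. \<phi> x \<noteq> 0 \<Longrightarrow> x \<in> {a..b}"
    using test_functionE[OF assms(2)] by metis
  show ?thesis
  proof (rule test_functionI[OF _ ab(1,2)])
    show "smooth (\<lambda>x. f x * \<phi> x)" by (intro smooth_mult test_function_smooth assms)
  qed (use ab(3) in force)
qed

section \<open>Uniqueness of weak derivatives\<close>

lemma
  fixes f :: "real \<Rightarrow> real"
  assumes "continuous_on {0..1} f"
  shows integrable_lebesgue_Omega: "integrable lebesgue_Omega f"
    and LINT_lebesgue_Omega: "(LINT x|lebesgue_Omega. f x) = integral {0..1} f"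
proof -
  have "f absolutely_integrable_on {0..1}"
    using assms by (intro absolutely_integrable_continuous_real)
  then have "f absolutely_integrable_on Omega"
    by (rule set_integrable_subset) auto
  then show *: "integrable lebesgue_Omega f"
    by (simp add: absolutely_integrable_on_def set_integrable_def integrable_restrict_space)
  show "(LINT x|lebesgue_Omega. f x) = integral {0..1} f"
    using lebesgue_integral_eq_integral[OF *] by (simp add: integral_open_interval_real)
qed

text \<open>Half-lines generate the Borel sets and are stable under intersection, so Dynkin's
  argument extends the vanishing to all Borel sets. The Borel representative \<open>g\<close> makes
  that induction applicable.\<close>

lemma AE_eq_0_if_integrals_eq_0:
  fixes f :: "real \<Rightarrow> real"
  assumes f: "integrable lebesgue f"
    and zero: "\<And>c. (LINT x:{..c}|lebesgue. f x) = 0"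
  shows "AE x in lebesgue. f x = 0"
proof -
  obtain g where g: "g \<in> borel_measurable lborel" "AE x in lborel. f x = g x"
    using completion_ex_borel_measurable_real[of f lborel] f by auto
  have fg: "AE x in lebesgue. f x = g x"
    using g(2) by (rule AE_completion)
  have gi: "integrable lborel g"
    using f integrable_cong_AE[OF _ _ fg] g(1)
    by (simp add: integrable_completion measurable_completion)
  have eq: "(LINT x:A|lborel. g x) = (LINT x:A|lebesgue. f x)" if "A \<in> sets borel" for A
  proof -
    have "(LINT x:A|lborel. g x) = (LINT x:A|lebesgue. g x)"
      using that g(1) unfolding set_lebesgue_integral_def by (subst integral_completion) auto
    also have "\<dots> = (LINT x:A|lebesgue. f x)"
      using that g(1) f fg by (intro set_lebesgue_integral_cong_AE)
       (auto intro: measurable_completion borel_measurable_integrable)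
    finally show ?thesis .
  qed
  have si: "set_integrable lborel A g" if "A \<in> sets borel" for A
    using gi that unfolding set_integrable_def by (intro integrable_mult_indicator) auto
  \<comment> \<open>The whole line is a limit of half-lines; its integral is needed for complements
    in the induction.\<close>
  have "(\<lambda>n. LINT x:{..real n}|lborel. g x) \<longlonglongrightarrow> (LINT x:(\<Union>n. {..real n})|lborel. g x)"
    by (intro set_integral_cont_up si) (auto simp: incseq_def)
  moreover have "(\<Union>n. {..real n}) = UNIV" using real_arch_simple by auto
  ultimately have total: "(LINT x:UNIV|lborel. g x) = 0"
    using eq zero by (simp add: LIMSEQ_const_iff)
  have "(LINT x:A|lborel. g x) = 0" if "A \<in> sigma_sets UNIV (range atMost)" for A
  proof (rule sigma_sets_induct_disjoint[OF _ _ that])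
    show "Int_stable (range (atMost :: real \<Rightarrow> _))"
      by (auto simp: Int_stable_def)
    show "range atMost \<subseteq> Pow (UNIV :: real set)" by simp
    show "(LINT x:A|lborel. g x) = 0" if "A \<in> range atMost" for A
      using that zero eq by auto
    show "(LINT x:{}|lborel. g x) = 0" by (simp add: set_lebesgue_integral_def)
  next
    fix A assume A: "A \<in> sigma_sets UNIV (range (atMost :: real \<Rightarrow> _))" "(LINT x:A|lborel. g x) = 0"
    show "(LINT x:UNIV - A|lborel. g x) = 0"
    proof -
      have m: "A \<in> sets borel" using A(1) by (simp add: borel_eq_atMost)
      have "(LINT x:A \<union> (UNIV - A)|lborel. g x) = (LINT x:A|lborel. g x) + (LINT x:UNIV - A|lborel. g x)"
        using m by (intro set_integral_Un si) auto
      then show ?thesis using A(2) total by simp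
    qed
  next
    fix A :: "nat \<Rightarrow> real set"
    assume A: "disjoint_family A" "range A \<subseteq> sigma_sets UNIV (range atMost)"
      "\<And>i. (LINT x:A i|lborel. g x) = 0"
    have m: "A i \<in> sets borel" for i using A(2) by (auto simp: borel_eq_atMost)
    have "(LINT x:(\<Union>i. A i)|lborel. g x) = (\<Sum>i. LINT x:A i|lborel. g x)"
      using A(1) m by (intro lebesgue_integral_countable_add si) (auto simp: disjoint_family_on_def)
    then show "(LINT x:(\<Union>i. A i)|lborel. g x) = 0" using A(3) by simp
  qed
  then have "(LINT x:A|lborel. g x) = 0" if "A \<in> sets borel" for A
    using that by (simp add: borel_eq_atMost)
  then have "AE x in lborel. g x = 0"
    using sigma_finite_measure.density_zero[OF sigma_finite_lborel gi] by simp
  then show ?thesis using fg AE_completion[of _ lborel] by fastforce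
qed

text \<open>As \<open>k\<close> tends to infinity, these test functions increase to the indicator of \<open>{a<..<b}\<close>.\<close>

lemma plateau_test_function:
  fixes k :: real
  assumes "0 < a" "b < 1"
  shows "(\<lambda>x. 1 - exp (- k * (flat 1 (x - a) * flat 1 (b - x)))) \<in> test_functions"
proof (rule test_functionI[OF _ assms])
  have "smooth (\<lambda>x. 1 + (-1) * exp ((- k) * (flat 1 (x + (-a)) * flat 1 (b + (-1) * x))))"
    by (intro smooth_intros)
  then show "smooth (\<lambda>x. 1 - exp (- k * (flat 1 (x - a) * flat 1 (b - x))))"
    by simp
qed (auto simp: flat_def split: if_splits)

text \<open>Plateaus with values in \<open>{0..1}\<close> tend pointwise to the indicator of the
  open interval, so dominated convergence applies; the endpoints are null. The empty case
  \<open>b < a\<close> occurs when a half-line misses the interval that it cuts.\<close>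

lemma fundamental_lemma_interval:
  assumes f: "f \<in> L1_loc" and ab: "0 < a" "b < 1"
    and zero: "\<And>\<phi>. \<phi> \<in> test_functions \<Longrightarrow> (LINT x|lebesgue_Omega. f x * \<phi> x) = 0"
  shows "(LINT x:{a..b}|lebesgue. f x) = 0"
proof -
  let ?\<phi> = "\<lambda>k x. 1 - exp (- real k * (flat 1 (x - a) * flat 1 (b - x)))"
  have exp_decay: "(\<lambda>k. exp (- real k * c)) \<longlonglongrightarrow> 0" if "0 < c" for c
    using that by real_asymp
  have int: "set_integrable lebesgue {a..b} f"
    using f ab by (auto simp: L1_loc_def compact_Icc subset_eq)
  have phi: "?\<phi> k x \<in> {0..1}" "x \<notin> {a..b} \<Longrightarrow> ?\<phi> k x = 0" for k x
    by (auto simp: flat_def)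
  have m: "?\<phi> k \<in> borel_measurable lebesgue" for k
    using smooth_continuous[OF test_function_smooth[OF plateau_test_function[OF ab]]]
    by (intro measurable_completion) (auto intro: borel_measurable_continuous_onI)
  have "(\<lambda>k. LINT x|lebesgue. ?\<phi> k x * (indicator {a..b} x * f x)) \<longlonglongrightarrow> (LINT x|lebesgue. indicator {a<..<b} x * (indicator {a..b} x * f x))"
  proof (rule integral_dominated_convergence[where w = "\<lambda>x. \<bar>indicator {a..b} x * f x\<bar>"])
    show "AE x in lebesgue. (\<lambda>k. ?\<phi> k x * (indicator {a..b} x * f x)) \<longlonglongrightarrow> indicator {a<..<b} x * (indicator {a..b} x * f x)"
    proof (intro AE_I2 tendsto_intros)
      fix x
      show "(\<lambda>k. ?\<phi> k x) \<longlonglongrightarrow> indicator {a<..<b} x"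
      proof (cases "x \<in> {a<..<b}")
        case True
        then have "0 < flat 1 (x - a) * flat 1 (b - x)" by (simp add: flat_def)
        then have "(\<lambda>k. exp (- real k * (flat 1 (x - a) * flat 1 (b - x)))) \<longlonglongrightarrow> 0"
          by (rule exp_decay)
        from tendsto_diff[OF tendsto_const this] True show ?thesis by fastforce
      next
        case False
        then show ?thesis by (auto simp: flat_def)
      qed
    qed
    show "AE x in lebesgue. norm (?\<phi> k x * (indicator {a..b} x * f x)) \<le> \<bar>indicator {a..b} x * f x\<bar>" for k
      using phi(1)[of k] by (intro AE_I2) (auto simp: abs_mult intro!: mult_left_le_one_le)
  qed (use int m in \<open>auto simp: set_integrable_def intro!: borel_measurable_times[of "indicator {a<..<b}"] borel_measurable_indicator\<close>)
  moreover have "(LINT x|lebesgue. ?\<phi> k x * (indicator {a..b} x * f x)) = 0" for k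
  proof -
    have "(LINT x|lebesgue. ?\<phi> k x * (indicator {a..b} x * f x)) = (LINT x|lebesgue. indicator Omega x *\<^sub>R (f x * ?\<phi> k x))"
      using ab phi(2) by (intro Bochner_Integration.integral_cong) (auto simp: indicator_def)
    also have "\<dots> = (LINT x|lebesgue_Omega. f x * ?\<phi> k x)"
      by (simp add: integral_restrict_space)
    also have "\<dots> = 0" by (intro zero plateau_test_function ab)
    finally show ?thesis .
  qed
  ultimately have "(LINT x|lebesgue. indicator {a<..<b} x * (indicator {a..b} x * f x)) = 0"
    by (simp add: LIMSEQ_const_iff)
  moreover have "(LINT x|lebesgue. indicator {a<..<b} x * (indicator {a..b} x * f x)) = (LINT x:{a..b}|lebesgue. f x)"
  proof -
    have "AE x in lebesgue. indicator {a<..<b} x * (indicator {a..b} x * f x) = indicator {a..b} x * f x"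
      using AE_completion[OF AE_lborel_singleton[of a]] AE_completion[OF AE_lborel_singleton[of b]]
      by eventually_elim (auto simp: indicator_def)
    moreover have "(\<lambda>x. indicator {a<..<b} x * (indicator {a..b} x * f x)) \<in> borel_measurable lebesgue"
      using int by (auto simp: set_integrable_def intro!: borel_measurable_times[of "indicator {a<..<b}"] borel_measurable_indicator)
    moreover have "(\<lambda>x. indicator {a..b} x * f x) \<in> borel_measurable lebesgue"
      using int by (auto simp: set_integrable_def)
    ultimately show ?thesis unfolding set_lebesgue_integral_def real_scaleR_def
      by (intro integral_cong_AE)
  qed
  ultimately show ?thesis by simp
qed

text \<open>Local integrability gives nothing up to the boundary, so \<open>f\<close> is cut off to
  compact intervals exhausting \<open>Omega\<close>; the intersection of such an interval with a
  half-line is an interval again.\<close>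

lemma fundamental_lemma:
  assumes f: "f \<in> L1_loc"
    and zero: "\<And>\<phi>. \<phi> \<in> test_functions \<Longrightarrow> (LINT x|lebesgue_Omega. f x * \<phi> x) = 0"
  shows "AE x in lebesgue_Omega. f x = 0"
proof -
  let ?I = "\<lambda>n::nat. {1 / (n + 2)..1 - 1 / (n + 2)}"
  have "AE x in lebesgue. indicator (?I n) x * f x = 0" for n
  proof (rule AE_eq_0_if_integrals_eq_0)
    have "?I n \<subseteq> Omega"
    proof
      fix x assume "x \<in> ?I n"
      moreover have "0 < 1 / real (n + 2)" by simp
      ultimately show "x \<in> Omega" unfolding greaterThanLessThan_iff atLeastAtMost_iff by linarith
    qed
    then show "integrable lebesgue (\<lambda>x. indicator (?I n) x * f x)"
      using f by (auto simp: L1_loc_def set_integrable_def)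
    fix c
    have "(LINT x:{..c}|lebesgue. indicator (?I n) x * f x) = (LINT x:{1 / (n + 2)..min c (1 - 1 / (n + 2))}|lebesgue. f x)"
      unfolding set_lebesgue_integral_def
      by (intro Bochner_Integration.integral_cong) (auto simp: indicator_def)
    also have "\<dots> = 0"
      using f by (intro fundamental_lemma_interval zero) (auto simp: min_less_iff_disj)
    finally show "(LINT x:{..c}|lebesgue. indicator (?I n) x * f x) = 0" .
  qed
  then have "AE x in lebesgue. \<forall>n. indicator (?I n) x * f x = 0"
    by (subst AE_all_countable) blast
  then have "AE x in lebesgue. x \<in> Omega \<longrightarrow> f x = 0"
  proof (rule eventually_mono)
    fix x assume *: "\<forall>n. indicator (?I n) x * f x = 0"
    show "x \<in> Omega \<longrightarrow> f x = 0"
    proof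
      assume x: "x \<in> Omega"
      obtain n where "inverse (real (Suc n)) < min x (1 - x)"
        using reals_Archimedean[of "min x (1 - x)"] x by auto
      moreover have "1 / real (n + 2) \<le> inverse (real (Suc n))" by (simp add: field_simps)
      ultimately have "x \<in> ?I n" unfolding atLeastAtMost_iff by linarith
      then show "f x = 0" using *[rule_format, of n] by (metis indicator_simps(1) mult_1)
    qed
  qed
  then show ?thesis by (simp add: AE_restrict_space_iff)
qed

lemma L1_loc_integrable_test:
  assumes "f \<in> L1_loc" "\<phi> \<in> test_functions"
  shows "integrable lebesgue_Omega (\<lambda>x. f x * \<phi> x)"
proof -
  obtain a b where ab: "0 < a" "b < 1" "\<And>x. \<phi> x \<noteq> 0 \<Longrightarrow> x \<in> {a..b}"
    using test_functionE[OF assms(2)] by metis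
  have "continuous_on {a..b} \<phi>" using assms(2) by (intro smooth_continuous test_function_smooth)
  then have "(\<lambda>x. \<phi> x * f x) absolutely_integrable_on {a..b}"
    using assms(1) ab
    by (intro absolutely_integrable_bounded_measurable_product_real continuous_imp_measurable_on_sets_lebesgue
        compact_imp_bounded compact_continuous_image) (auto simp: L1_loc_def compact_Icc subset_eq)
  also have "?this \<longleftrightarrow> integrable lebesgue (\<lambda>x. indicator Omega x *\<^sub>R (f x * \<phi> x))"
    unfolding set_integrable_def using ab
    by (intro Bochner_Integration.integrable_cong) (auto simp: indicator_def)
  finally show ?thesis by (simp add: integrable_restrict_space)
qed

text \<open>Since \<open>weak_deriv\<close> selects some weak derivative, this is what permits
  computing with any known one.\<close>

lemma has_weak_deriv_unique:
  assumes "has_weak_deriv v g" "has_weak_deriv v h"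
  shows "AE x in lebesgue_Omega. g x = h x"
proof -
  have L: "g \<in> L1_loc" "h \<in> L1_loc" using assms by (auto simp: has_weak_deriv_def)
  have "AE x in lebesgue_Omega. g x - h x = 0"
  proof (rule fundamental_lemma)
    show "(\<lambda>x. g x - h x) \<in> L1_loc" using L by (auto simp: L1_loc_def)
    fix \<phi> assume \<phi>: "\<phi> \<in> test_functions"
    then have "(LINT x|lebesgue_Omega. g x * \<phi> x) = (LINT x|lebesgue_Omega. h x * \<phi> x)"
      using assms by (simp add: has_weak_deriv_def)
    then show "(LINT x|lebesgue_Omega. (g x - h x) * \<phi> x) = 0"
      using L1_loc_integrable_test[OF _ \<phi>] L by (simp add: left_diff_distrib)
  qed
  then show ?thesis by simp
qed

section \<open>Sobolev spaces on the interval\<close>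

text \<open>Lebesgue measure is complete, so measurability passes along equality almost everywhere;
  extension by zero reduces \<open>Omega\<close> to the whole line.\<close>

lemma
  fixes f g :: "real \<Rightarrow> real"
  assumes "g \<in> borel_measurable lebesgue_Omega" "AE x in lebesgue_Omega. f x = g x"
  shows measurable_cong_AE_Omega: "f \<in> borel_measurable lebesgue_Omega"
    and LINT_cong_AE_Omega: "(LINT x|lebesgue_Omega. f x) = (LINT x|lebesgue_Omega. g x)"
proof -
  have "(\<lambda>x. if x \<in> Omega then g x else 0) \<in> borel_measurable lebesgue"
    using assms(1) by (subst borel_measurable_if) auto
  moreover have "AE x in lebesgue. (if x \<in> Omega then g x else 0) = (if x \<in> Omega then f x else 0)"
    using assms(2) by (subst (asm) AE_restrict_space_iff) (auto elim: eventually_mono)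
  ultimately have "(\<lambda>x. if x \<in> Omega then f x else 0) \<in> borel_measurable lebesgue"
    by (rule borel_measurable_AE)
  then show *: "f \<in> borel_measurable lebesgue_Omega"
    by (subst (asm) borel_measurable_if) auto
  show "(LINT x|lebesgue_Omega. f x) = (LINT x|lebesgue_Omega. g x)"
    using * assms by (intro integral_cong_AE)
qed

lemma emeasure_lebesgue_Omega: "emeasure lebesgue_Omega (space lebesgue_Omega) = 1"
  by (simp add: emeasure_restrict_space)

lemma finite_measure_lebesgue_Omega: "finite_measure lebesgue_Omega"
  by (rule finite_measureI) (use emeasure_lebesgue_Omega in simp)

lemma L2_measurable: "f \<in> L2 \<Longrightarrow> f \<in> borel_measurable lebesgue_Omega"
  and L2_square_integrable: "f \<in> L2 \<Longrightarrow> integrable lebesgue_Omega (\<lambda>x. (f x)\<^sup>2)"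
  by (auto simp: L2_def)

lemma L2_mult_integrable:
  assumes "f \<in> L2" "g \<in> L2"
  shows "integrable lebesgue_Omega (\<lambda>x. f x * g x)"
proof (rule Bochner_Integration.integrable_bound)
  show "integrable lebesgue_Omega (\<lambda>x. (f x)\<^sup>2 + (g x)\<^sup>2)"
    using assms by (simp add: L2_def)
  have "\<bar>f x * g x\<bar> \<le> (f x)\<^sup>2 + (g x)\<^sup>2" for x
  proof -
    have "0 \<le> \<bar>f x\<bar> * \<bar>g x\<bar>" by simp
    then show ?thesis
      using sum_squares_bound[of "\<bar>f x\<bar>" "\<bar>g x\<bar>"] unfolding abs_mult power2_abs by linarith
  qed
  then show "AE x in lebesgue_Omega. norm (f x * g x) \<le> norm ((f x)\<^sup>2 + (g x)\<^sup>2)" by simp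
  show "(\<lambda>x. f x * g x) \<in> borel_measurable lebesgue_Omega"
    by (intro borel_measurable_times L2_measurable assms)
qed

lemma continuous_L2: "continuous_on {0..1} f \<Longrightarrow> f \<in> L2"
  unfolding L2_def
  by (auto intro!: borel_measurable_integrable integrable_lebesgue_Omega continuous_intros)

lemma L2_integrable: "f \<in> L2 \<Longrightarrow> integrable lebesgue_Omega f"
  using L2_mult_integrable[of "\<lambda>_. 1" f] continuous_L2[of "\<lambda>_. 1"] by simp

lemma L2_add: "f \<in> L2 \<Longrightarrow> g \<in> L2 \<Longrightarrow> (\<lambda>x. f x + g x) \<in> L2"
  using L2_mult_integrable[of f g]
  by (auto simp: L2_def power2_sum mult.assoc intro!: borel_measurable_add Bochner_Integration.integrable_add)

lemma L2_uminus: "f \<in> L2 \<Longrightarrow> (\<lambda>x. - f x) \<in> L2"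
  by (auto simp: L2_def)

lemma L2_diff: "f \<in> L2 \<Longrightarrow> g \<in> L2 \<Longrightarrow> (\<lambda>x. f x - g x) \<in> L2"
  using L2_add[OF _ L2_uminus, of f g] by simp

lemma L2_cong_AE:
  assumes "g \<in> L2" "AE x in lebesgue_Omega. f x = g x"
  shows "f \<in> L2"
proof -
  have f: "f \<in> borel_measurable lebesgue_Omega"
    by (rule measurable_cong_AE_Omega[OF L2_measurable[OF assms(1)] assms(2)])
  have "AE x in lebesgue_Omega. (g x)\<^sup>2 = (f x)\<^sup>2"
    using assms(2) by eventually_elim simp
  then have "integrable lebesgue_Omega (\<lambda>x. (f x)\<^sup>2)"
    by (rule integrable_cong_AE_imp[OF L2_square_integrable[OF assms(1)] borel_measurable_power[OF f]])
  with f show ?thesis by (simp add: L2_def)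
qed

lemma abs_LINT_mult_le:
  assumes h: "continuous_on {0..1} h" "\<And>x. x \<in> {0..1} \<Longrightarrow> \<bar>h x\<bar> \<le> B" and f: "f \<in> L2"
  shows "\<bar>LINT x|lebesgue_Omega. h x * f x\<bar> \<le> B * sqrt (LINT x|lebesgue_Omega. (f x)\<^sup>2)"
proof -
  let ?a = "LINT x|lebesgue_Omega. \<bar>f x\<bar>"
  have int: "integrable lebesgue_Omega f" by (rule L2_integrable[OF f])
  have hf: "integrable lebesgue_Omega (\<lambda>x. h x * f x)"
    by (intro L2_mult_integrable continuous_L2 h f)
  have B: "0 \<le> B" using h(2)[of 0] by auto
  \<comment> \<open>\<open>Omega\<close> has measure one: nonnegativity of the variance of
    \<open>\<bar>f x\<bar>\<close> bounds its mean by the root of its mean square.\<close>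
  have "0 \<le> (LINT x|lebesgue_Omega. (\<bar>f x\<bar> - ?a)\<^sup>2)" by simp
  also have "\<dots> = (LINT x|lebesgue_Omega. (f x)\<^sup>2 - 2 * ?a * \<bar>f x\<bar> + ?a\<^sup>2)"
    by (simp add: power2_diff algebra_simps)
  also have "\<dots> = (LINT x|lebesgue_Omega. (f x)\<^sup>2) - 2 * ?a * ?a + (LINT x|lebesgue_Omega. ?a\<^sup>2)"
    using int L2_square_integrable[OF f]
    by (simp add: finite_measure.integrable_const[OF finite_measure_lebesgue_Omega])
  also have "(LINT x|lebesgue_Omega. ?a\<^sup>2) = ?a\<^sup>2"
    using emeasure_lebesgue_Omega by (simp add: measure_def)
  finally have a: "?a \<le> sqrt (LINT x|lebesgue_Omega. (f x)\<^sup>2)"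
    by (intro real_le_rsqrt) (simp add: power2_eq_square)
  have "\<bar>LINT x|lebesgue_Omega. h x * f x\<bar> \<le> (LINT x|lebesgue_Omega. \<bar>h x * f x\<bar>)"
    by (rule integral_abs_bound)
  also have "\<dots> \<le> (LINT x|lebesgue_Omega. B * \<bar>f x\<bar>)"
    using int integrable_abs[OF hf] h(2)
    by (intro integral_mono) (auto simp: abs_mult intro!: mult_right_mono)
  also have "\<dots> \<le> B * sqrt (LINT x|lebesgue_Omega. (f x)\<^sup>2)"
    using mult_left_mono[OF a B] by simp
  finally show ?thesis .
qed

lemma continuous_L1_loc:
  assumes "continuous_on {0..1} f"
  shows "f \<in> L1_loc"
  unfolding L1_loc_def
proof (intro CollectI allI impI)
  fix K assume K: "compact K \<and> K \<subseteq> Omega"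
  then have "K \<in> sets lebesgue" by (simp add: borel_compact)
  then show "f absolutely_integrable_on K"
    by (rule set_integrable_subset[OF absolutely_integrable_continuous_real[OF assms]]) (use K in auto)
qed

lemma smooth_integral_by_parts:
  assumes "smooth v" "\<phi> \<in> test_functions"
  shows "integral {0..1} (\<lambda>x. v x * deriv \<phi> x) = - integral {0..1} (\<lambda>x. deriv v x * \<phi> x)"
proof -
  have \<phi>: "smooth \<phi>" by (rule test_function_smooth[OF assms(2)])
  obtain a b where ab: "0 < a" "b < 1" "\<And>x. \<phi> x \<noteq> 0 \<Longrightarrow> x \<in> {a..b}"
    using test_functionE[OF assms(2)] by metis
  have "\<phi> 0 = 0" "\<phi> 1 = 0" using ab by fastforce+
  moreover have deriv: "((\<lambda>x. v x * \<phi> x) has_field_derivative v x * deriv \<phi> x + deriv v x * \<phi> x) (at x)" for x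
    by (intro DERIV_mult' smooth_DERIV assms(1) \<phi>)
  ultimately have "((\<lambda>x. v x * deriv \<phi> x + deriv v x * \<phi> x) has_integral 0) {0..1}"
    using fundamental_theorem_of_calculus[of 0 1 "\<lambda>x. v x * \<phi> x" "\<lambda>x. v x * deriv \<phi> x + deriv v x * \<phi> x"]
    by (simp add: deriv has_field_derivative_at_within flip: has_real_derivative_iff_has_vector_derivative)
  moreover have "(\<lambda>x. v x * deriv \<phi> x) integrable_on {0..1}" "(\<lambda>x. deriv v x * \<phi> x) integrable_on {0..1}"
    by (intro integrable_continuous_real continuous_intros smooth_continuous smooth_deriv assms \<phi>)+
  ultimately show ?thesis
    using integral_add[of "\<lambda>x. v x * deriv \<phi> x" "{0..1}" "\<lambda>x. deriv v x * \<phi> x"]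
    by (simp add: integral_unique)
qed

lemma smooth_has_weak_deriv:
  assumes "smooth v"
  shows "has_weak_deriv v (deriv v)"
  unfolding has_weak_deriv_def
proof (intro conjI ballI)
  show "v \<in> L1_loc" "deriv v \<in> L1_loc"
    by (intro continuous_L1_loc smooth_continuous smooth_deriv assms)+
  fix \<phi> assume \<phi>: "\<phi> \<in> test_functions"
  show "(LINT x|lebesgue_Omega. v x * deriv \<phi> x) = - (LINT x|lebesgue_Omega. deriv v x * \<phi> x)"
    using smooth_integral_by_parts[OF assms \<phi>] assms test_function_smooth[OF \<phi>]
    by (subst (1 2) LINT_lebesgue_Omega)
      (intro continuous_intros smooth_continuous smooth_deriv; assumption | simp)+
qed

lemma weak_deriv_AE_eq:
  assumes "has_weak_deriv v g"
  shows "AE x in lebesgue_Omega. weak_deriv v x = g x"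
  unfolding weak_deriv_def
  using someI[where P = "has_weak_deriv v" and x = g] assms by (intro has_weak_deriv_unique[of v]) auto

lemma has_weak_deriv_diff:
  assumes "has_weak_deriv v g" "has_weak_deriv w h"
  shows "has_weak_deriv (\<lambda>x. v x - w x) (\<lambda>x. g x - h x)"
  unfolding has_weak_deriv_def
proof (intro conjI ballI)
  have L: "v \<in> L1_loc" "w \<in> L1_loc" "g \<in> L1_loc" "h \<in> L1_loc"
    using assms by (auto simp: has_weak_deriv_def)
  then show "(\<lambda>x. v x - w x) \<in> L1_loc" "(\<lambda>x. g x - h x) \<in> L1_loc"
    by (auto simp: L1_loc_def)
  fix \<phi> assume \<phi>: "\<phi> \<in> test_functions"
  then show "(LINT x|lebesgue_Omega. (v x - w x) * deriv \<phi> x) = - (LINT x|lebesgue_Omega. (g x - h x) * \<phi> x)"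
    using assms L L1_loc_integrable_test[OF _ \<phi>] L1_loc_integrable_test[OF _ test_function_deriv[OF \<phi>]]
    by (simp add: left_diff_distrib has_weak_deriv_def)
qed

lemma H1_weak_deriv:
  assumes "v \<in> H1"
  shows "has_weak_deriv v (weak_deriv v)" "weak_deriv v \<in> L2"
proof -
  obtain g where g: "g \<in> L2" "has_weak_deriv v g" using assms by (auto simp: H1_def)
  show "has_weak_deriv v (weak_deriv v)" unfolding weak_deriv_def
    using someI[where P = "has_weak_deriv v" and x = g] g(2) by blast
  show "weak_deriv v \<in> L2" by (rule L2_cong_AE[OF g(1) weak_deriv_AE_eq[OF g(2)]])
qed

lemma smooth_L2: "smooth v \<Longrightarrow> v \<in> L2"
  by (intro continuous_L2 smooth_continuous)

lemma smooth_H1: "smooth v \<Longrightarrow> v \<in> H1"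
  unfolding H1_def using smooth_L2 smooth_has_weak_deriv smooth_deriv by blast

lemma H1_norm_eq:
  assumes "has_weak_deriv v g" "g \<in> L2"
  shows "H1_norm v = sqrt ((LINT x|lebesgue_Omega. (v x)\<^sup>2) + (LINT x|lebesgue_Omega. (g x)\<^sup>2))"
proof -
  have "AE x in lebesgue_Omega. (weak_deriv v x)\<^sup>2 = (g x)\<^sup>2"
    using weak_deriv_AE_eq[OF assms(1)] by eventually_elim simp
  then show ?thesis
    using assms(2) unfolding H1_norm_def
    by (subst LINT_cong_AE_Omega[of "\<lambda>x. (g x)\<^sup>2"]) (auto simp: L2_def)
qed

lemma H1_norm_smooth:
  assumes "smooth v"
  shows "H1_norm v = sqrt (integral {0..1} (\<lambda>x. (v x)\<^sup>2 + (deriv v x)\<^sup>2))"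
proof -
  have c: "continuous_on {0..1} (\<lambda>x. (v x)\<^sup>2)" "continuous_on {0..1} (\<lambda>x. (deriv v x)\<^sup>2)"
    by (intro continuous_intros smooth_continuous smooth_deriv assms)+
  have "integral {0..1} (\<lambda>x. (v x)\<^sup>2 + (deriv v x)\<^sup>2)
      = integral {0..1} (\<lambda>x. (v x)\<^sup>2) + integral {0..1} (\<lambda>x. (deriv v x)\<^sup>2)"
    by (intro integral_add integrable_continuous_real c)
  then show ?thesis
    by (simp add: H1_norm_eq[OF smooth_has_weak_deriv[OF assms] smooth_L2[OF smooth_deriv[OF assms]]]
        LINT_lebesgue_Omega c)
qed

lemma test_function_H10: "\<phi> \<in> test_functions \<Longrightarrow> \<phi> \<in> H10"
  unfolding H10_def
  using H1_norm_smooth[OF smooth_const[of 0]] by (auto intro!: smooth_H1 test_function_smooth)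

lemma zero_H10: "(\<lambda>_. 0) \<in> H10"
  by (intro test_function_H10 test_functionI[of _ "1/2" "1/2"] smooth_const) auto

text \<open>The identity holds for test functions, and both integrals are continuous in the
  \<open>H1_norm\<close>. Approximability of \<open>\<phi>\<close> by test functions removes the
  boundary terms, although \<open>f\<close> may be nonzero at the endpoints.\<close>

lemma H10_integral_by_parts:
  assumes f: "smooth f" and "\<phi> \<in> H10"
  shows "(LINT x|lebesgue_Omega. f x * weak_deriv \<phi> x) = - (LINT x|lebesgue_Omega. deriv f x * \<phi> x)"
proof -
  obtain \<psi> where \<phi>: "\<phi> \<in> H1" and \<psi>: "\<And>n::nat. \<psi> n \<in> test_functions"
    and lim: "(\<lambda>n. H1_norm (\<lambda>x. \<phi> x - \<psi> n x)) \<longlonglongrightarrow> 0"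
    using assms(2) by (auto simp: H10_def)
  have \<phi>L: "\<phi> \<in> L2" using \<phi> by (simp add: H1_def)
  note w = H1_weak_deriv[OF \<phi>]
  note \<psi>s = test_function_smooth[OF \<psi>]
  obtain B where B: "\<And>x. x \<in> {0..1} \<Longrightarrow> \<bar>f x\<bar> \<le> B" "\<And>x. x \<in> {0..1} \<Longrightarrow> \<bar>deriv f x\<bar> \<le> B"
  proof -
    have "bounded (f ` {0..1})" "bounded (deriv f ` {0..1})"
      by (intro compact_imp_bounded compact_continuous_image smooth_continuous smooth_deriv f compact_Icc)+
    then obtain B C where "\<forall>x\<in>{0..1}. \<bar>f x\<bar> \<le> B" "\<forall>x\<in>{0..1}. \<bar>deriv f x\<bar> \<le> C"
      by (auto simp: bounded_real)
    then show ?thesis using that[of "max B C"] by (meson max.coboundedI1 max.coboundedI2)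
  qed
  have B0: "0 \<le> B" using B(1)[of 0] by auto
  let ?A = "(LINT x|lebesgue_Omega. f x * weak_deriv \<phi> x) + (LINT x|lebesgue_Omega. deriv f x * \<phi> x)"
  have "\<bar>?A\<bar> \<le> 2 * B * H1_norm (\<lambda>x. \<phi> x - \<psi> n x)" for n
  proof -
    let ?d0 = "LINT x|lebesgue_Omega. (\<phi> x - \<psi> n x)\<^sup>2"
    let ?d1 = "LINT x|lebesgue_Omega. (weak_deriv \<phi> x - deriv (\<psi> n) x)\<^sup>2"
    have d: "(\<lambda>x. \<phi> x - \<psi> n x) \<in> L2" "(\<lambda>x. weak_deriv \<phi> x - deriv (\<psi> n) x) \<in> L2"
      by (intro L2_diff \<phi>L w smooth_L2 \<psi>s smooth_deriv)+
    have norm: "H1_norm (\<lambda>x. \<phi> x - \<psi> n x) = sqrt (?d0 + ?d1)"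
      by (intro H1_norm_eq has_weak_deriv_diff w smooth_has_weak_deriv \<psi>s d)
    have "(LINT x|lebesgue_Omega. f x * deriv (\<psi> n) x) = - (LINT x|lebesgue_Omega. deriv f x * \<psi> n x)"
      using smooth_has_weak_deriv[OF f] \<psi> by (auto simp: has_weak_deriv_def)
    then have "?A = (LINT x|lebesgue_Omega. f x * (weak_deriv \<phi> x - deriv (\<psi> n) x)) + (LINT x|lebesgue_Omega. deriv f x * (\<phi> x - \<psi> n x))"
      using L2_mult_integrable[OF smooth_L2[OF f] w(2)] L2_mult_integrable[OF smooth_L2[OF smooth_deriv[OF f]] \<phi>L]
        L2_mult_integrable[OF smooth_L2[OF f] smooth_L2[OF smooth_deriv[OF \<psi>s]], of n]
        L2_mult_integrable[OF smooth_L2[OF smooth_deriv[OF f]] smooth_L2[OF \<psi>s], of n]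
      by (simp add: right_diff_distrib)
    then have "\<bar>?A\<bar> = \<bar>(LINT x|lebesgue_Omega. f x * (weak_deriv \<phi> x - deriv (\<psi> n) x)) + (LINT x|lebesgue_Omega. deriv f x * (\<phi> x - \<psi> n x))\<bar>"
      by simp
    also have "\<dots> \<le> B * sqrt ?d1 + B * sqrt ?d0"
      by (intro order_trans[OF abs_triangle_ineq] add_mono abs_LINT_mult_le B smooth_continuous smooth_deriv f d)
    also have "\<dots> \<le> B * sqrt (?d0 + ?d1) + B * sqrt (?d0 + ?d1)"
      using B0 by (intro add_mono mult_left_mono real_sqrt_le_mono) simp_all
    finally show ?thesis by (simp add: norm)
  qed
  moreover have "(\<lambda>n. 2 * B * H1_norm (\<lambda>x. \<phi> x - \<psi> n x)) \<longlonglongrightarrow> 2 * B * 0"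
    by (intro tendsto_intros lim)
  ultimately have "\<bar>?A\<bar> \<le> 0"
    using LIMSEQ_le_const[of _ "2 * B * 0" "\<bar>?A\<bar>"] by simp
  then show ?thesis by simp
qed

section \<open>Members of \<open>H10\<close> and weak convergence to zero\<close>

lemma deriv_add_smooth:
  assumes "smooth f" "smooth g"
  shows "deriv (\<lambda>x. f x + g x) = (\<lambda>x. deriv f x + deriv g x)"
  by (intro ext DERIV_imp_deriv DERIV_add smooth_DERIV assms)

lemma deriv_cmult_smooth:
  assumes "smooth f"
  shows "deriv (\<lambda>x. c * f x) = (\<lambda>x. c * deriv f x)"
  by (intro ext DERIV_imp_deriv DERIV_cmult smooth_DERIV assms)

lemma smooth_add_test_H10:
  assumes "v \<in> H10" "smooth v" "r \<in> test_functions"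
  shows "(\<lambda>x. v x + r x) \<in> H10"
proof -
  obtain \<psi> where \<psi>: "\<And>n::nat. \<psi> n \<in> test_functions" "(\<lambda>n. H1_norm (\<lambda>x. v x - \<psi> n x)) \<longlonglongrightarrow> 0"
    using assms(1) by (auto simp: H10_def)
  moreover have "(\<lambda>x. v x + r x - (\<psi> n x + r x)) = (\<lambda>x. v x - \<psi> n x)" for n by simp
  moreover have "(\<lambda>x. v x + r x) \<in> H1"
    by (intro smooth_H1 smooth_add test_function_smooth assms)
  ultimately show ?thesis
    unfolding H10_def using assms(3)
    by (auto intro!: exI[of _ "\<lambda>n x. \<psi> n x + r x"] test_function_add)
qed

text \<open>The function \<open>s exp (-1/s)\<close> is a smooth substitute for the positive part: truncating \<open>v\<close> below
  a small level by means of it yields test functions.\<close>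

lemma positive_smooth_H10:
  assumes v: "smooth v" and pos: "\<And>x. x \<in> Omega \<Longrightarrow> 0 < v x" and neg: "\<And>x. x \<notin> Omega \<Longrightarrow> v x \<le> 0"
  shows "v \<in> H10"
proof -
  \<comment> \<open>\<open>s k\<close> is positive exactly where \<open>v\<close> exceeds
    \<open>1 / (k + 1)\<close>, so \<open>\<phi> k\<close> vanishes near the ends of
    \<open>Omega\<close>; dividing by \<open>k + 1\<close> undoes the rescaling.\<close>
  define s where "s k x = real (Suc k) * v x - 1" for k x
  define \<phi> where "\<phi> k x = s k x * flat 1 (s k x) / real (Suc k)" for k x
  \<comment> \<open>\<open>E\<close> is the derivative of \<open>t * flat 1 t\<close>. It lies in
    \<open>{0..1}\<close> because \<open>1 + y \<le> exp y\<close> for \<open>y = 1 / t\<close>, so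
    \<open>deriv (\<phi> k)\<close> is a damped copy of \<open>deriv v\<close>.\<close>
  define E where "E t = flat 1 t + t * flat [:0, 0, 1:] t" for t
  have E: "E t \<in> {0..1}" for t
  proof (cases "0 < t")
    case True
    then have "E t = (1 + 1 / t) / exp (1 / t)"
      by (simp add: E_def flat_def exp_minus field_simps power2_eq_square)
    then show ?thesis using True exp_ge_add_one_self[of "1 / t"] by (simp add: divide_le_eq)
  qed (simp add: E_def flat_def)
  have G: "t * flat 1 t \<in> {0..max t 0}" for t
    by (auto simp: flat_def)
  have \<phi>s: "smooth (\<phi> k)" for k
  proof -
    have "smooth (\<lambda>x. (1 / real (Suc k)) * ((real (Suc k) * v x + (-1)) * flat 1 (real (Suc k) * v x + (-1))))"
      by (intro smooth_intros v)
    then show ?thesis by (simp add: \<phi>_def [abs_def] s_def)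
  qed
  have \<phi>d: "deriv (\<phi> k) = (\<lambda>x. E (s k x) * deriv v x)" for k
  proof (rule ext, rule DERIV_imp_deriv)
    fix x
    have "(s k has_field_derivative real (Suc k) * deriv v x) (at x)"
      unfolding s_def [abs_def] by (auto intro!: derivative_eq_intros smooth_DERIV v)
    moreover have "((\<lambda>t. t * flat 1 t) has_field_derivative E (s k x)) (at (s k x))"
      using DERIV_mult'[OF DERIV_ident DERIV_flat[of 1 "s k x"]] by (simp add: E_def add.commute)
    ultimately have "((\<lambda>x. s k x * flat 1 (s k x)) has_field_derivative E (s k x) * (real (Suc k) * deriv v x)) (at x)"
      by (rule DERIV_chain2[rotated])
    from DERIV_cdivide[OF this, of "real (Suc k)"]
    show "(\<phi> k has_field_derivative E (s k x) * deriv v x) (at x)"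
      by (simp add: \<phi>_def [abs_def])
  qed
  have \<phi>t: "\<phi> k \<in> test_functions" for k
  proof -
    let ?K = "{0..1} \<inter> {x. 1 / real (Suc k) \<le> v x}"
    have "closed {x. 1 / real (Suc k) \<le> v x}"
      using smooth_continuous[OF v] by (intro closed_Collect_le continuous_intros)
    then have K: "compact ?K" by (intro compact_Int_closed) auto
    have KO: "?K \<subseteq> Omega"
    proof
      fix x assume x: "x \<in> ?K"
      have "0 < 1 / real (Suc k)" by simp
      moreover have "1 / real (Suc k) \<le> v x" using x by blast
      ultimately have "0 < v x" by linarith
      then show "x \<in> Omega" using neg by force
    qed
    have sub: "{x. \<phi> k x \<noteq> 0} \<subseteq> ?K"
    proof
      fix x assume "x \<in> {x. \<phi> k x \<noteq> 0}"
      then have "0 < s k x" by (auto simp: \<phi>_def flat_def split: if_splits)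
      then have "1 / real (Suc k) < v x" by (simp add: s_def field_simps)
      moreover from this have "0 < v x" by (meson less_trans of_nat_0_less_iff zero_less_Suc zero_less_divide_1_iff)
      then have "x \<in> Omega" using neg by force
      ultimately show "x \<in> ?K" by auto
    qed
    have "closure {x. \<phi> k x \<noteq> 0} \<subseteq> ?K"
      using sub K by (intro closure_minimal compact_imp_closed)
    moreover from this have "compact (closure {x. \<phi> k x \<noteq> 0})"
      using K by (meson bounded_subset closed_closure compact_eq_bounded_closed)
    ultimately show ?thesis
      using \<phi>s[of k] KO unfolding test_functions_def smooth_def by blast
  qed
  let ?D = "\<lambda>k x. (v x - \<phi> k x)\<^sup>2 + (deriv v x - deriv (\<phi> k) x)\<^sup>2"
  have norm: "H1_norm (\<lambda>x. v x - \<phi> k x) = sqrt (integral Omega (?D k))" for k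
  proof -
    have "smooth (\<lambda>x. v x + (-1) * \<phi> k x)" by (intro smooth_intros v \<phi>s)
    then have s: "smooth (\<lambda>x. v x - \<phi> k x)" by simp
    have "deriv (\<lambda>x. v x - \<phi> k x) = (\<lambda>x. deriv v x - deriv (\<phi> k) x)"
      by (intro ext DERIV_imp_deriv DERIV_diff smooth_DERIV v \<phi>s)
    then show ?thesis
      using H1_norm_smooth[OF s] by (simp add: integral_open_interval_real)
  qed
  have c: "continuous_on {0..1} (?D k)" "continuous_on {0..1} (\<lambda>x. (v x)\<^sup>2 + (deriv v x)\<^sup>2)" for k
    by (intro continuous_intros smooth_continuous smooth_deriv v \<phi>s)+
  have "(\<lambda>k. integral Omega (?D k)) \<longlonglongrightarrow> integral Omega (\<lambda>x. 0)"
  \<comment> \<open>On \<open>Omega\<close>, \<open>\<phi> k\<close> lies between 0 and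
    \<open>v\<close>, and the damping factor between 0 and 1; hence the energy density of
    \<open>v\<close> dominates that of the error.\<close>
  proof (rule dominated_convergence(2))
    show "?D k integrable_on Omega" "(\<lambda>x. (v x)\<^sup>2 + (deriv v x)\<^sup>2) integrable_on Omega" for k
      unfolding integrable_on_open_interval_real by (intro integrable_continuous_real c)+
    fix x assume x: "x \<in> Omega"
    show "norm (?D k x) \<le> (v x)\<^sup>2 + (deriv v x)\<^sup>2" for k
    proof -
      have "0 \<le> \<phi> k x" using G[of "s k x"] by (simp add: \<phi>_def)
      moreover have "\<phi> k x \<le> v x"
      proof -
        have "s k x * flat 1 (s k x) \<le> max (s k x) 0" using G[of "s k x"] by simp
        also have "\<dots> \<le> real (Suc k) * v x" using pos[OF x] by (simp add: s_def)
        finally show ?thesis by (simp add: \<phi>_def field_simps)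
      qed
      ultimately have "(v x - \<phi> k x)\<^sup>2 \<le> (v x)\<^sup>2" by (intro power_mono) auto
      moreover have "(deriv v x - deriv (\<phi> k) x)\<^sup>2 \<le> (deriv v x)\<^sup>2"
      proof -
        have "deriv v x - deriv (\<phi> k) x = (1 - E (s k x)) * deriv v x" by (simp add: \<phi>d algebra_simps)
        then have "(deriv v x - deriv (\<phi> k) x)\<^sup>2 = (1 - E (s k x))\<^sup>2 * (deriv v x)\<^sup>2"
          by (simp add: power_mult_distrib)
        also have "\<dots> \<le> 1 * (deriv v x)\<^sup>2"
          using E[of "s k x"] by (intro mult_right_mono power_le_one) auto
        finally show ?thesis by simp
      qed
      ultimately show ?thesis by simp
    qed
    have lim1: "(\<lambda>k. \<phi> k x) \<longlonglongrightarrow> v x" if "0 < v x"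
    proof -
      have "(\<lambda>k. (real (Suc k) * c - 1) * exp (- 1 / (real (Suc k) * c - 1)) / real (Suc k)) \<longlonglongrightarrow> c" if "0 < c" for c
        using that by real_asymp
      from this[OF pos[OF x]] show ?thesis
      proof (rule Lim_transform_eventually)
        have "\<forall>\<^sub>F k in sequentially. 0 < real (Suc k) * c - 1" if "0 < c" for c
          using that by real_asymp
        from this[OF pos[OF x]]
        show "\<forall>\<^sub>F k in sequentially. (real (Suc k) * v x - 1) * exp (- 1 / (real (Suc k) * v x - 1)) / real (Suc k) = \<phi> k x"
          by eventually_elim (simp add: \<phi>_def s_def flat_def)
      qed
    qed
    have lim2: "(\<lambda>k. E (s k x)) \<longlonglongrightarrow> 1"
    proof -
      have "(\<lambda>k. (1 + 1 / (real (Suc k) * c - 1)) * exp (- 1 / (real (Suc k) * c - 1))) \<longlonglongrightarrow> 1" if "0 < c" for c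
        using that by real_asymp
      from this[OF pos[OF x]] show ?thesis
      proof (rule Lim_transform_eventually)
        have "\<forall>\<^sub>F k in sequentially. 0 < real (Suc k) * c - 1" if "0 < c" for c
          using that by real_asymp
        from this[OF pos[OF x]]
        show "\<forall>\<^sub>F k in sequentially. (1 + 1 / (real (Suc k) * v x - 1)) * exp (- 1 / (real (Suc k) * v x - 1)) = E (s k x)"
          by eventually_elim (simp add: E_def s_def flat_def distrib_right)
      qed
    qed
    have "(\<lambda>k. ?D k x) \<longlonglongrightarrow> (v x - v x)\<^sup>2 + (deriv v x - 1 * deriv v x)\<^sup>2"
      unfolding \<phi>d by (intro tendsto_intros lim1 lim2 pos x)
    then show "(\<lambda>k. ?D k x) \<longlonglongrightarrow> 0" by simp
  qed
  then have "(\<lambda>k. sqrt (integral Omega (?D k))) \<longlonglongrightarrow> sqrt 0"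
    by (intro tendsto_real_sqrt) simp
  then show ?thesis
    unfolding H10_def using smooth_H1[OF v] \<phi>t by (auto simp: norm intro!: exI[of _ \<phi>])
qed

text \<open>Integration by parts moves the derivative in the cross term from \<open>r\<close> to
  \<open>S\<close>. For fixed \<open>S\<close> this term then sees only the values of
  \<open>r\<close>, and is small if \<open>r\<close> is uniformly small.\<close>

lemma H1_norm_add_cmult_test:
  assumes "smooth S" "r \<in> test_functions"
  shows "(H1_norm (\<lambda>x. S x + c * r x))\<^sup>2 = (H1_norm S)\<^sup>2
    + 2 * c * integral {0..1} (\<lambda>x. (S x - deriv (deriv S) x) * r x) + c\<^sup>2 * (H1_norm r)\<^sup>2"
proof -
  let ?S' = "deriv S" let ?r' = "deriv r"
  have r: "smooth r" by (rule test_function_smooth[OF assms(2)])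
  have cr: "smooth (\<lambda>x. c * r x)" by (intro smooth_mult smooth_const r)
  note smooths = assms(1) r smooth_deriv[OF r] smooth_deriv[OF assms(1)] smooth_deriv[OF smooth_deriv[OF assms(1)]]
  have i: "(\<lambda>x. (S x)\<^sup>2 + (?S' x)\<^sup>2) integrable_on {0..1}" "(\<lambda>x. (r x)\<^sup>2 + (?r' x)\<^sup>2) integrable_on {0..1}"
    "(\<lambda>x. S x * r x) integrable_on {0..1}" "(\<lambda>x. ?S' x * ?r' x) integrable_on {0..1}"
    "(\<lambda>x. deriv ?S' x * r x) integrable_on {0..1}"
    by (intro integrable_continuous_real continuous_intros smooth_continuous smooths)+
  have sq: "(H1_norm f)\<^sup>2 = integral {0..1} (\<lambda>x. (f x)\<^sup>2 + (deriv f x)\<^sup>2)" if "smooth f" for f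
    using that by (simp add: H1_norm_smooth integral_nonneg integrable_continuous_real continuous_intros
        smooth_continuous smooth_deriv)
  have "(H1_norm (\<lambda>x. S x + c * r x))\<^sup>2 = integral {0..1} (\<lambda>x. ((S x)\<^sup>2 + (?S' x)\<^sup>2)
     + ((2 * c) * (S x * r x) + (2 * c) * (?S' x * ?r' x) + c\<^sup>2 * ((r x)\<^sup>2 + (?r' x)\<^sup>2)))"
    by (subst sq) (auto simp: deriv_add_smooth deriv_cmult_smooth assms(1) r cr power2_eq_square algebra_simps
      intro!: smooth_add assms(1) cr)
  also have "\<dots> = (H1_norm S)\<^sup>2 + (2 * c * integral {0..1} (\<lambda>x. S x * r x)
     + 2 * c * integral {0..1} (\<lambda>x. ?S' x * ?r' x) + c\<^sup>2 * (H1_norm r)\<^sup>2)"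
    unfolding sq[OF assms(1)] sq[OF r]
    by (intro integral_unique has_integral_add has_integral_mult_right integrable_integral i)
  also have "integral {0..1} (\<lambda>x. ?S' x * ?r' x) = - integral {0..1} (\<lambda>x. deriv ?S' x * r x)"
    by (intro smooth_integral_by_parts smooth_deriv assms)
  also have "(H1_norm S)\<^sup>2 + (2 * c * integral {0..1} (\<lambda>x. S x * r x)
     + 2 * c * - integral {0..1} (\<lambda>x. deriv ?S' x * r x) + c\<^sup>2 * (H1_norm r)\<^sup>2)
    = (H1_norm S)\<^sup>2 + 2 * c * (integral {0..1} (\<lambda>x. S x * r x - deriv ?S' x * r x)) + c\<^sup>2 * (H1_norm r)\<^sup>2"
    using i by (simp add: integral_diff algebra_simps)
  finally show ?thesis by (simp add: left_diff_distrib)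
qed

text \<open>A uniformly null sequence is asymptotically orthogonal to every test function. If \<open>l (r j)\<close>
  stayed away from \<open>0\<close>, sums \<open>S\<close> of \<open>N\<close> almost orthogonal terms \<open>\<plusminus> r j\<close> would satisfy \<open>l S \<ge> c N\<close> and
  \<open>H1_norm S = O(\<surd>N)\<close>.\<close>

lemma bounded_functional_tendsto_0:
  assumes l: "bounded_functional_H10 l" and r: "\<And>j. r j \<in> test_functions"
    and bnd: "\<And>j. (H1_norm (r j))\<^sup>2 \<le> C"
    and unif: "\<And>j x. \<bar>r j x\<bar> \<le> b j" "b \<longlonglongrightarrow> 0"
  shows "(\<lambda>j. l (r j)) \<longlonglongrightarrow> 0"
proof (rule ccontr)
  assume "\<not> ?thesis"
  then obtain c where c: "0 < c" "\<And>N. \<exists>j\<ge>N. c \<le> \<bar>l (r j)\<bar>"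
    by (auto simp: LIMSEQ_iff not_less)
  obtain K where K: "\<And>v. v \<in> H10 \<Longrightarrow> \<bar>l v\<bar> \<le> K * H1_norm v"
    using l unfolding bounded_functional_H10_def by blast
  have l_add: "l (\<lambda>x. v x + a * w x) = l v + a * l w" if "v \<in> H10" "w \<in> test_functions" for v w a
  proof -
    have "(\<lambda>x. a * w x) \<in> H10" "w \<in> H10"
      using that(2) by (auto intro!: test_function_H10 test_function_mult smooth_const)
    then show ?thesis using that(1) l by (auto simp: bounded_functional_H10_def)
  qed
  have C: "0 \<le> C" using bnd[of 0] zero_le_power2 order_trans by blast
  \<comment> \<open>A greedy step adds at most \<open>C\<close> for the new term and at most 2 for
    the cross term, once the index is large enough for the current \<open>S\<close>.\<close>
  have "\<exists>S\<in>test_functions. (H1_norm S)\<^sup>2 \<le> N * (C + 2) \<and> c * N \<le> l S" for N :: nat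
  proof (induction N)
    case 0
    have z: "(\<lambda>x. 0) \<in> test_functions"
      by (intro test_functionI[of _ "1/2" "1/2"] smooth_const) auto
    moreover have "H1_norm (\<lambda>x. 0) = 0" by (simp add: H1_norm_smooth smooth_const)
    moreover from this have "l (\<lambda>x. 0) = 0" using K[OF test_function_H10[OF z]] by simp
    ultimately show ?case by (intro bexI[of _ "\<lambda>x. 0"]) auto
  next
    case (Suc N)
    then obtain S where S: "S \<in> test_functions" "(H1_norm S)\<^sup>2 \<le> N * (C + 2)" "c * N \<le> l S" by blast
    note Ss = test_function_smooth[OF S(1)]
    let ?g = "\<lambda>x. S x - deriv (deriv S) x"
    let ?i = "\<lambda>j. integral {0..1} (\<lambda>x. ?g x * r j x)"
    have gc: "continuous_on {0..1} ?g" by (intro continuous_intros smooth_continuous smooth_deriv Ss)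
    obtain M where M: "\<And>x. x \<in> {0..1} \<Longrightarrow> \<bar>?g x\<bar> \<le> M"
      using compact_imp_bounded[OF compact_continuous_image[OF gc compact_Icc]]
      unfolding bounded_real by blast
    have "norm (?i j) \<le> M * b j * (1 - 0)" for j
    proof (rule integral_bound)
      show "continuous_on {0..1} (\<lambda>x. ?g x * r j x)"
        by (intro continuous_intros gc smooth_continuous test_function_smooth r)
      fix x :: real assume "x \<in> {0..1}"
      then show "norm (?g x * r j x) \<le> M * b j"
        using M[of x] unif(1)[of j x] unfolding real_norm_def abs_mult by (intro mult_mono) auto
    qed simp
    then have "\<forall>j. norm (?i j) \<le> M * b j" by simp
    then have "?i \<longlonglongrightarrow> 0"
      by (rule Lim_null_comparison[OF always_eventually tendsto_mult_right_zero[OF unif(2)]])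
    then obtain N0 where N0: "\<And>j. j \<ge> N0 \<Longrightarrow> \<bar>?i j\<bar> \<le> 1"
      by (fastforce simp: LIMSEQ_iff dest: spec[of _ 1])
    obtain j where j: "j \<ge> N0" "c \<le> \<bar>l (r j)\<bar>" using c(2) by blast
    \<comment> \<open>The sign makes the values of \<open>l\<close> add up without
      cancellation.\<close>
    define a :: real where "a = sgn (l (r j))"
    let ?T = "\<lambda>x. S x + a * r j x"
    have "?T \<in> test_functions"
      by (intro test_function_add S test_function_mult smooth_const r)
    moreover have "(H1_norm ?T)\<^sup>2 \<le> Suc N * (C + 2)"
    proof -
      have "2 * a * ?i j \<le> 2" using N0[OF j(1)] by (auto simp: a_def sgn_if)
      moreover have "a\<^sup>2 * (H1_norm (r j))\<^sup>2 \<le> C" using bnd[of j] C by (auto simp: a_def sgn_if)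
      ultimately show ?thesis
        using S(2) by (simp add: H1_norm_add_cmult_test[OF Ss r] algebra_simps)
    qed
    moreover have "c * Suc N \<le> l ?T"
    proof -
      have "a * l (r j) = \<bar>l (r j)\<bar>" by (simp add: a_def sgn_mult_abs abs_sgn)
      then show ?thesis
        using l_add[OF test_function_H10[OF S(1)] r, of a j] S(3) j(2) by (simp add: algebra_simps)
    qed
    ultimately show ?case by blast
  qed
  \<comment> \<open>Boundedness of \<open>l\<close> now compares \<open>(c * N)\<^sup>2\<close> with
    a squared norm that is only linear in \<open>N\<close>, which bounds \<open>N\<close>.\<close>
  note greedy = this
  have "c\<^sup>2 * real N \<le> K\<^sup>2 * (C + 2)" if "0 < N" for N :: nat
  proof -
    obtain S where S: "S \<in> test_functions" "(H1_norm S)\<^sup>2 \<le> N * (C + 2)" "c * N \<le> l S"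
      using greedy by blast
    have "c * N \<le> K * H1_norm S" using K[OF test_function_H10[OF S(1)]] S(3) by simp
    then have "(c * N)\<^sup>2 \<le> (K * H1_norm S)\<^sup>2" using c(1) by (intro power_mono) auto
    also have "\<dots> \<le> K\<^sup>2 * (N * (C + 2))" using S(2) by (simp add: power_mult_distrib mult_left_mono)
    finally have "(c\<^sup>2 * N) * N \<le> (K\<^sup>2 * (C + 2)) * N" by (simp add: power2_eq_square mult_ac)
    then show ?thesis using that by simp
  qed
  then have bound: "real N \<le> K\<^sup>2 * (C + 2) / c\<^sup>2" if "0 < N" for N :: nat
    using that c(1) by (simp add: pos_le_divide_eq mult.commute)
  obtain N :: nat where N: "K\<^sup>2 * (C + 2) / c\<^sup>2 < N" using reals_Archimedean2 by blast
  moreover have "0 \<le> K\<^sup>2 * (C + 2) / c\<^sup>2" using C by simp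
  ultimately have "0 < N" by linarith
  from bound[OF this] N show False by linarith
qed

section \<open>Oscillations and tilted Hamiltonians\<close>

lemma test_function_bounded:
  assumes "\<phi> \<in> test_functions"
  obtains B where "0 < B" "\<And>x. \<bar>\<phi> x\<bar> \<le> B" "\<And>x. \<bar>deriv \<phi> x\<bar> \<le> B"
proof -
  have *: "\<exists>B. \<forall>x. \<bar>f x\<bar> \<le> B" if f: "f \<in> test_functions" for f
  proof -
    have "bounded (f ` {0..1})"
      by (intro compact_imp_bounded compact_continuous_image smooth_continuous test_function_smooth f compact_Icc)
    then obtain B where B: "\<forall>x\<in>{0..1}. \<bar>f x\<bar> \<le> B" by (auto simp: bounded_real)
    obtain a b where ab: "0 < a" "b < 1" "\<And>x. f x \<noteq> 0 \<Longrightarrow> x \<in> {a..b}"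
      using test_functionE[OF f] by metis
    have "\<bar>f x\<bar> \<le> \<bar>B\<bar>" for x
    proof (cases "f x = 0")
      case False
      then have "x \<in> {0..1}" using ab(3)[of x] ab(1,2) by auto
      then show ?thesis using B by force
    qed simp
    then show ?thesis by blast
  qed
  obtain B where B: "\<And>x. \<bar>\<phi> x\<bar> \<le> B" using *[OF assms] by blast
  obtain C where C: "\<And>x. \<bar>deriv \<phi> x\<bar> \<le> C" using *[OF test_function_deriv[OF assms]] by blast
  show ?thesis
    by (rule that[of "max 1 (max B C)"]) (use B C in \<open>auto simp: le_max_iff_disj\<close>)
qed

text \<open>The waves are \<open>\<eta> x sin (n x) / n\<close> with \<open>n = j + 1\<close> and a fixed bump \<open>\<eta>\<close>: they tend to \<open>0\<close>
  uniformly, while the square of the derivative behaves like \<open>(\<eta> x cos (n x))\<^sup>2\<close>, of mean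
  \<open>(\<eta> x)\<^sup>2 / 2\<close>.\<close>

lemma oscillating_test_functions:
  fixes \<delta> :: real
  assumes \<delta>: "0 < \<delta>"
  obtains w :: "nat \<Rightarrow> real \<Rightarrow> real" and L :: real
  where "\<And>j. w j \<in> test_functions" "\<And>j x. w j x \<noteq> 0 \<Longrightarrow> x \<in> {1/4..3/4}"
    "\<And>j x. \<bar>w j x\<bar> \<le> \<delta> / real (Suc j)" "\<And>j x. \<bar>deriv (w j) x\<bar> \<le> \<delta>"
    "0 < L" "(\<lambda>j. H1_norm (w j)) \<longlonglongrightarrow> L"
proof -
  define \<beta> where "\<beta> x = flat 1 (x - 1/4) * flat 1 (3/4 - x)" for x
  have \<beta>s: "\<beta> x \<noteq> 0 \<Longrightarrow> x \<in> {1/4..3/4}" for x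
    by (auto simp: \<beta>_def flat_def split: if_splits)
  have "smooth (\<lambda>x. flat 1 (x + (- 1/4)) * flat 1 (3/4 + (- 1) * x))" by (intro smooth_intros)
  then have \<beta>t: "\<beta> \<in> test_functions"
    by (intro test_functionI[OF _ _ _ \<beta>s]) (auto simp: \<beta>_def [abs_def])
  obtain B where B: "0 < B" "\<And>x. \<bar>\<beta> x\<bar> \<le> B" "\<And>x. \<bar>deriv \<beta> x\<bar> \<le> B"
    using test_function_bounded[OF \<beta>t] by blast
  \<comment> \<open>The scaling makes \<open>\<eta>\<close> and its derivative at most
    \<open>\<delta> / 2\<close>; each enters one of the two terms of
    \<open>deriv (w j)\<close>.\<close>
  define \<eta> where "\<eta> x = (\<delta> / (2 * B)) * \<beta> x" for x
  have \<eta>t: "\<eta> \<in> test_functions"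
    unfolding \<eta>_def [abs_def] by (intro test_function_mult smooth_const \<beta>t)
  note \<eta>sm = test_function_smooth[OF \<eta>t]
  note \<eta>D = smooth_DERIV[OF \<eta>sm]
  have \<eta>b: "\<bar>\<eta> x\<bar> \<le> \<delta> / 2" "\<bar>deriv \<eta> x\<bar> \<le> \<delta> / 2" for x
  proof -
    have "deriv \<eta> x = (\<delta> / (2 * B)) * deriv \<beta> x"
      unfolding \<eta>_def [abs_def] deriv_cmult_smooth[OF test_function_smooth[OF \<beta>t]] ..
    then have "\<bar>\<eta> x\<bar> = \<delta> / (2 * B) * \<bar>\<beta> x\<bar>" "\<bar>deriv \<eta> x\<bar> = \<delta> / (2 * B) * \<bar>deriv \<beta> x\<bar>"
      using B(1) \<delta> by (simp_all only: \<eta>_def abs_mult) auto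
    moreover have "\<delta> / (2 * B) * y \<le> \<delta> / 2" if "y \<le> B" for y
      using B(1) \<delta> that by (simp add: field_simps)
    ultimately show "\<bar>\<eta> x\<bar> \<le> \<delta> / 2" "\<bar>deriv \<eta> x\<bar> \<le> \<delta> / 2"
      using B(2,3) by simp_all
  qed
  define N where "N j = real (Suc j)" for j
  have N: "1 \<le> N j" for j by (simp add: N_def)
  define w where "w j x = sin (N j * x) / N j * \<eta> x" for j x
  have wd: "deriv (w j) x = sin (N j * x) / N j * deriv \<eta> x + cos (N j * x) * \<eta> x" for j x
    unfolding w_def [abs_def] using N[of j]
    by (intro DERIV_imp_deriv) (auto intro!: derivative_eq_intros \<eta>D simp: field_simps)
  have "smooth (\<lambda>x. (1 / N j) * sin (N j * x))" for j by (intro smooth_intros)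
  then have ss: "smooth (\<lambda>x. sin (N j * x) / N j)" for j by simp
  have wt: "w j \<in> test_functions" for j
    unfolding w_def [abs_def] by (intro test_function_mult ss \<eta>t)
  have sN: "\<bar>sin y / N j\<bar> \<le> 1 / N j" for y j using N[of j] by (simp add: divide_right_mono)
  let ?\<phi> = "\<lambda>x. \<eta> x * \<eta> x" and ?v = "\<lambda>j x. sin (2 * N j * x) / (2 * N j)"
  let ?I = "\<lambda>j x. (w j x)\<^sup>2 + (deriv (w j) x)\<^sup>2"
  have \<phi>t: "?\<phi> \<in> test_functions" by (intro test_function_mult \<eta>sm \<eta>t)
  have \<phi>d: "deriv ?\<phi> x = 2 * \<eta> x * deriv \<eta> x" for x
    by (intro DERIV_imp_deriv) (auto intro!: derivative_eq_intros \<eta>D)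
  have "smooth (\<lambda>x. (1 / (2 * N j)) * sin (2 * N j * x))" for j by (intro smooth_intros)
  then have vs: "smooth (?v j)" for j by simp
  have vd: "deriv (?v j) x = cos (2 * N j * x)" for j x
    using N[of j] by (intro DERIV_imp_deriv) (auto intro!: derivative_eq_intros)
  note cont = smooth_continuous[OF \<eta>sm] smooth_continuous[OF smooth_deriv[OF \<eta>sm]] smooth_continuous[OF ss]
    smooth_continuous[OF vs]
    smooth_continuous[OF test_function_smooth[OF wt]] smooth_continuous[OF smooth_deriv[OF test_function_smooth[OF wt]]]
  \<comment> \<open>Subtracted are the mean density \<open>(\<eta> x)\<^sup>2 / 2\<close> and half
    the derivative of \<open>?v j x * ?\<phi> x\<close>, which integrates to zero. By the double
    angle formula for cosine, every remaining term carries a factor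
    \<open>sin (N j * x) / N j\<close>, so \<open>?K j\<close> is uniformly small although
    \<open>?I j\<close> is not.\<close>
  let ?K = "\<lambda>j x. ?I j x - (1/2) * (\<eta> x)\<^sup>2 - (1/2) * (deriv (?v j) x * ?\<phi> x) - (1/2) * (?v j x * deriv ?\<phi> x)"
  have Kc: "continuous_on {0..1} (?K j)" for j
    unfolding vd \<phi>d
    by (intro continuous_on_diff continuous_on_add continuous_on_mult continuous_on_power continuous_on_cos
        continuous_on_const continuous_on_id cont)
  have Kb: "\<bar>?K j x\<bar> \<le> 2 * \<delta>\<^sup>2 / N j" for j x
  proof -
    let ?s = "sin (N j * x)" and ?c = "cos (N j * x)" and ?e = "\<eta> x" and ?f = "deriv \<eta> x"
    have "?K j x = (?s / N j)\<^sup>2 * (?e\<^sup>2 + ?f\<^sup>2) + (?s / N j) * ?c * (?e * ?f)"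
    proof -
      have v: "?v j x = ?s / N j * ?c" and c: "cos (2 * N j * x) = 2 * ?c\<^sup>2 - 1"
        using sin_double[of "N j * x"] cos_double_cos[of "N j * x"] by (simp_all add: mult.assoc)
      have "(S * e)\<^sup>2 + (S * f + C * e)\<^sup>2 - (1/2) * e\<^sup>2 - (1/2) * ((2 * C\<^sup>2 - 1) * (e * e))
          - (1/2) * (S * C * (2 * e * f)) = S\<^sup>2 * (e\<^sup>2 + f\<^sup>2) + S * C * (e * f)" for S C e f :: real
        by (simp add: power2_eq_square algebra_simps)
      then show ?thesis unfolding vd \<phi>d wd w_def v c .
    qed
    also have "\<bar>\<dots>\<bar> \<le> (1 / N j) * (\<delta>\<^sup>2 / 2) + (1 / N j) * 1 * (\<delta>\<^sup>2 / 4)"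
    proof -
      have e2: "?e\<^sup>2 \<le> (\<delta>/2)\<^sup>2" "?f\<^sup>2 \<le> (\<delta>/2)\<^sup>2"
        using \<eta>b[of x] \<delta> by (metis abs_le_square_iff abs_of_pos half_gt_zero)+
      have "(?s / N j)\<^sup>2 \<le> (1 / N j)\<^sup>2"
        using sN[of "N j * x" j] N[of j] by (intro power2_le_iff_abs_le[THEN iffD2]) auto
      also have "\<dots> \<le> 1 / N j" using N[of j] by (simp add: power2_eq_square divide_simps)
      finally have s2: "(?s / N j)\<^sup>2 \<le> 1 / N j" .
      have "(?s / N j)\<^sup>2 * (?e\<^sup>2 + ?f\<^sup>2) \<le> (1 / N j) * (\<delta>\<^sup>2 / 2)"
        using s2 e2 N[of j] by (intro mult_mono) (auto simp: power_divide)
      moreover have "\<bar>(?s / N j) * ?c * (?e * ?f)\<bar> \<le> (1 / N j) * 1 * (\<delta> / 2 * (\<delta> / 2))"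
        unfolding abs_mult[of _ "?e * ?f"] abs_mult[of _ ?c] abs_mult[of ?e]
        using sN[of "N j * x" j] \<eta>b[of x] \<delta> N[of j] by (intro mult_mono) auto
      moreover have "\<delta> / 2 * (\<delta> / 2) = \<delta>\<^sup>2 / 4" by (simp add: power2_eq_square)
      moreover have "\<bar>(?s / N j)\<^sup>2 * (?e\<^sup>2 + ?f\<^sup>2)\<bar> = (?s / N j)\<^sup>2 * (?e\<^sup>2 + ?f\<^sup>2)"
        by (intro abs_of_nonneg) simp
      ultimately show ?thesis
        by (intro order_trans[OF abs_triangle_ineq] add_mono) simp_all
    qed
    also have "\<dots> \<le> 2 * \<delta>\<^sup>2 / N j" using N[of j] by (simp add: field_simps)
    finally show ?thesis .
  qed
  have "norm (integral {0..1} (?K j)) \<le> 2 * \<delta>\<^sup>2 / N j * (1 - 0)" for j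
    by (rule integral_bound) (use Kc Kb in auto)
  moreover have "integral {0..1} (?K j) = integral {0..1} (?I j) - (1/2) * integral {0..1} (\<lambda>x. (\<eta> x)\<^sup>2)" for j
  proof -
    have i: "?I j integrable_on {0..1}" "(\<lambda>x. (\<eta> x)\<^sup>2) integrable_on {0..1}"
      "(\<lambda>x. deriv (?v j) x * ?\<phi> x) integrable_on {0..1}" "(\<lambda>x. ?v j x * deriv ?\<phi> x) integrable_on {0..1}"
      unfolding vd \<phi>d
      by (intro integrable_continuous_real continuous_on_add continuous_on_mult continuous_on_power
          continuous_on_cos continuous_on_const continuous_on_id cont)+
    have "integral {0..1} (?K j) = integral {0..1} (?I j) - (1/2) * integral {0..1} (\<lambda>x. (\<eta> x)\<^sup>2)
      - (1/2) * integral {0..1} (\<lambda>x. deriv (?v j) x * ?\<phi> x) - (1/2) * integral {0..1} (\<lambda>x. ?v j x * deriv ?\<phi> x)"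
      by (intro integral_unique has_integral_diff has_integral_mult_right integrable_integral i)
    then show ?thesis by (simp only: smooth_integral_by_parts[OF vs \<phi>t])
  qed
  ultimately have "\<forall>j. norm (integral {0..1} (?I j) - (1/2) * integral {0..1} (\<lambda>x. (\<eta> x)\<^sup>2)) \<le> 2 * \<delta>\<^sup>2 / N j"
    by simp
  moreover have "(\<lambda>j. 2 * \<delta>\<^sup>2 / N j) \<longlonglongrightarrow> 0"
    unfolding N_def by real_asymp
  ultimately have "(\<lambda>j. integral {0..1} (?I j) - (1/2) * integral {0..1} (\<lambda>x. (\<eta> x)\<^sup>2)) \<longlonglongrightarrow> 0"
    by (rule Lim_null_comparison[OF always_eventually])
  then have "(\<lambda>j. sqrt (integral {0..1} (?I j))) \<longlonglongrightarrow> sqrt ((1/2) * integral {0..1} (\<lambda>x. (\<eta> x)\<^sup>2))"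
    by (intro tendsto_real_sqrt) (simp add: LIM_zero_iff)
  then have lim: "(\<lambda>j. H1_norm (w j)) \<longlonglongrightarrow> sqrt ((1/2) * integral {0..1} (\<lambda>x. (\<eta> x)\<^sup>2))"
    by (simp add: H1_norm_smooth test_function_smooth[OF wt])
  have \<eta>c: "continuous_on {0..1} (\<lambda>x. (\<eta> x)\<^sup>2)" by (intro continuous_intros cont)
  have "integral {0..1} (\<lambda>x. (\<eta> x)\<^sup>2) \<noteq> 0"
  proof
    assume "integral {0..1} (\<lambda>x. (\<eta> x)\<^sup>2) = 0"
    then have "(\<eta> (1/2))\<^sup>2 = 0" using integral_eq_0_iff[OF \<eta>c] by auto
    then show False using \<delta> B(1) by (simp add: \<eta>_def \<beta>_def flat_def)
  qed
  moreover have "0 \<le> integral {0..1} (\<lambda>x. (\<eta> x)\<^sup>2)"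
    by (intro integral_nonneg integrable_continuous_real \<eta>c) auto
  ultimately have pos: "0 < sqrt ((1/2) * integral {0..1} (\<lambda>x. (\<eta> x)\<^sup>2))" by simp
  have b0: "\<bar>w j x\<bar> \<le> \<delta> / real (Suc j)" for j x
  proof -
    have "\<bar>w j x\<bar> \<le> (1 / N j) * (\<delta> / 2)"
      unfolding w_def abs_mult by (intro mult_mono sN \<eta>b) (use N[of j] in auto)
    also have "\<dots> \<le> \<delta> / N j" using N[of j] \<delta> by (simp add: field_simps)
    finally show ?thesis by (simp add: N_def)
  qed
  have b1: "\<bar>deriv (w j) x\<bar> \<le> \<delta>" for j x
  proof -
    have "\<bar>sin (N j * x) / N j\<bar> \<le> 1" using N[of j] by (intro order_trans[OF sN]) simp
    then have "\<bar>sin (N j * x) / N j * deriv \<eta> x\<bar> \<le> 1 * (\<delta> / 2)" "\<bar>cos (N j * x) * \<eta> x\<bar> \<le> 1 * (\<delta> / 2)"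
      unfolding abs_mult using \<eta>b[of x] by (intro mult_mono; simp)+
    then show ?thesis unfolding wd by linarith
  qed
  show thesis
    by (rule that[OF wt _ b0 b1 pos lim]) (use \<beta>s in \<open>auto simp: w_def \<eta>_def\<close>)
qed

text \<open>The norm is that of the complex number \<open>p + e z\<close>, where \<open>\<bar>z\<bar> = 1\<close> and the real part \<open>s\<close> of \<open>z\<close> is
  the prescribed slope at \<open>p = 0\<close>.\<close>

definition tilted_norm :: "real \<Rightarrow> real \<Rightarrow> real \<Rightarrow> real" where
  "tilted_norm s e p = cmod (Complex (p + e * s) (e * sqrt (1 - s\<^sup>2))) - e"

text \<open>Completing the square leaves the remainder \<open>e\<^sup>2 * (1 - s\<^sup>2)\<close>,
  so a slope below one in modulus keeps the radicand away from zero.\<close>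

lemma
  assumes s: "\<bar>s\<bar> < 1" and e: "0 < e"
  shows tilted_norm_eq: "tilted_norm s e p = sqrt (p\<^sup>2 + 2 * e * s * p + e\<^sup>2) - e"
    and tilted_norm_pos: "0 < p\<^sup>2 + 2 * e * s * p + e\<^sup>2"
proof -
  have s2: "s\<^sup>2 < 1" using s by (simp add: abs_square_less_1)
  have eq: "p\<^sup>2 + 2 * e * s * p + e\<^sup>2 = (p + e * s)\<^sup>2 + e\<^sup>2 * (1 - s\<^sup>2)"
    by (simp add: power2_eq_square algebra_simps)
  show "0 < p\<^sup>2 + 2 * e * s * p + e\<^sup>2" unfolding eq using s2 e by (intro add_nonneg_pos) auto
  show "tilted_norm s e p = sqrt (p\<^sup>2 + 2 * e * s * p + e\<^sup>2) - e"
    unfolding tilted_norm_def eq using s2 by (simp add: cmod_def power_mult_distrib)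
qed

lemma tilted_norm_0: "\<bar>s\<bar> < 1 \<Longrightarrow> 0 < e \<Longrightarrow> tilted_norm s e 0 = 0"
  by (simp add: tilted_norm_eq)

lemma DERIV_tilted_norm:
  assumes "\<bar>s\<bar> < 1" "0 < e"
  shows "(tilted_norm s e has_field_derivative (p + e * s) / sqrt (p\<^sup>2 + 2 * e * s * p + e\<^sup>2)) (at p)"
  using tilted_norm_pos[OF assms, of p]
  unfolding tilted_norm_eq[OF assms, abs_def]
  by (auto intro!: derivative_eq_intros simp: field_simps)

lemma tilted_norm_lipschitz: "\<bar>tilted_norm s e p - tilted_norm s e q\<bar> \<le> \<bar>p - q\<bar>"
proof -
  let ?z = "\<lambda>p. Complex (p + e * s) (e * sqrt (1 - s\<^sup>2))"
  have "?z p - ?z q = complex_of_real (p - q)" by (simp add: complex_eq_iff)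
  then have "cmod (?z p - ?z q) = \<bar>p - q\<bar>" by (simp only: norm_of_real)
  then show ?thesis
    using norm_triangle_ineq3[of "?z p" "?z q"] by (simp add: tilted_norm_def)
qed

text \<open>The complex number is affine in \<open>p\<close>, and its modulus is a convex function
  of it.\<close>

lemma tilted_norm_convex: "convex_on UNIV (tilted_norm s e)"
proof (rule convex_onI)
  fix t p q :: real assume t: "0 < t" "t < 1"
  let ?z = "\<lambda>p. Complex (p + e * s) (e * sqrt (1 - s\<^sup>2))"
  have "?z ((1 - t) * p + t * q) = complex_of_real (1 - t) * ?z p + complex_of_real t * ?z q"
    by (simp add: complex_eq_iff algebra_simps)
  then have "cmod (?z ((1 - t) * p + t * q)) \<le> (1 - t) * cmod (?z p) + t * cmod (?z q)"
    using t norm_triangle_ineq[of "complex_of_real (1 - t) * ?z p" "complex_of_real t * ?z q"]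
    by (simp add: norm_mult del: of_real_diff)
  then show "tilted_norm s e ((1 - t) *\<^sub>R p + t *\<^sub>R q) \<le> (1 - t) * tilted_norm s e p + t * tilted_norm s e q"
    by (simp add: tilted_norm_def algebra_simps)
qed simp

text \<open>The shift of \<open>p\<close> by a number of modulus \<open>e\<close> costs
  \<open>e\<close>, and so does the final subtraction.\<close>

lemma tilted_norm_approx:
  assumes "\<bar>s\<bar> < 1" "0 < e"
  shows "\<bar>tilted_norm s e p - \<bar>p\<bar>\<bar> \<le> 2 * e"
proof -
  let ?z = "Complex (p + e * s) (e * sqrt (1 - s\<^sup>2))" and ?w = "Complex (e * s) (e * sqrt (1 - s\<^sup>2))"
  have "?z - complex_of_real p = ?w" by (simp add: complex_eq_iff)
  moreover have "cmod ?w = e" using tilted_norm_0[OF assms] by (simp add: tilted_norm_def)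
  ultimately have "\<bar>cmod ?z - \<bar>p\<bar>\<bar> \<le> e"
    using norm_triangle_ineq3[of ?z "complex_of_real p"] by simp
  then show ?thesis by (simp add: tilted_norm_def)
qed

text \<open>The factor \<open>x\<close> in \<open>{0..1}\<close> keeps convexity, the Lipschitz
  constant 1 and the error bound \<open>2 * e\<close>. The strict bound on \<open>\<sigma>\<close>
  keeps the denominator of the derivative positive, and continuity of \<open>\<sigma> j\<close>
  gives joint continuity.\<close>

lemma admissible_tilted_family:
  assumes \<sigma>: "\<And>j. continuous_on UNIV (\<sigma> j)" "\<And>j x. \<bar>\<sigma> j x\<bar> < 1" and lam: "\<And>j. 0 < lam j"
  shows "admissible_family mfg_H lam (\<lambda>j x p. x * tilted_norm (\<sigma> j x) (lam j) p)"
  unfolding admissible_family_def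
proof (intro exI[of _ "\<lambda>t. 2 * t"] exI[of _ 1] conjI allI ballI)
  have lip: "1-lipschitz_on UNIV (\<lambda>p. x * f p)"
    if "x \<in> {0..1}" "\<And>p q. \<bar>f p - f q\<bar> \<le> \<bar>p - q\<bar>" for x :: real and f :: "real \<Rightarrow> real"
  proof (rule lipschitz_onI)
    fix p q
    have "dist (x * f p) (x * f q) = x * \<bar>f p - f q\<bar>"
      using that(1) by (simp add: dist_real_def abs_mult flip: right_diff_distrib)
    also have "\<dots> \<le> 1 * \<bar>p - q\<bar>" using that by (intro mult_mono) auto
    finally show "dist (x * f p) (x * f q) \<le> 1 * dist p q" by (simp add: dist_real_def)
  qed simp
  fix x :: real assume x: "x \<in> {0..1}"
  then have "mfg_H x = (\<lambda>p. x * \<bar>p\<bar>)" by (auto simp: mfg_H_eq)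
  then show "1-lipschitz_on UNIV (mfg_H x)" using lip[OF x, of abs] by (simp add: abs_triangle_ineq3)
  fix j
  show "1-lipschitz_on UNIV (\<lambda>p. x * tilted_norm (\<sigma> j x) (lam j) p)"
    by (intro lip x tilted_norm_lipschitz)
  show "convex_on UNIV (\<lambda>p. x * tilted_norm (\<sigma> j x) (lam j) p)"
    using x by (intro convex_on_cmul tilted_norm_convex) auto
  fix p
  show "(\<lambda>p. x * tilted_norm (\<sigma> j x) (lam j) p) field_differentiable at p"
    using DERIV_cmult[OF DERIV_tilted_norm[OF \<sigma>(2) lam]] field_differentiable_def by blast
  have "\<bar>x * tilted_norm (\<sigma> j x) (lam j) p - mfg_H x p\<bar> = x * \<bar>tilted_norm (\<sigma> j x) (lam j) p - \<bar>p\<bar>\<bar>"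
    using x by (simp add: mfg_H_eq abs_mult flip: right_diff_distrib)
  also have "\<dots> \<le> 1 * (2 * lam j)"
    using x by (intro mult_mono tilted_norm_approx \<sigma> lam) auto
  finally show "\<bar>x * tilted_norm (\<sigma> j x) (lam j) p - mfg_H x p\<bar> \<le> 2 * lam j" by simp
next
  fix j
  have \<sigma>c: "continuous_on ({0..1} \<times> UNIV) (\<lambda>z. \<sigma> j (fst z))"
    by (rule continuous_on_compose2[OF \<sigma>(1)]) (auto intro: continuous_intros)
  have "continuous_on ({0..1} \<times> UNIV) (\<lambda>z. fst z * (sqrt ((snd z)\<^sup>2 + 2 * lam j * \<sigma> j (fst z) * snd z + (lam j)\<^sup>2) - lam j))"
    by (intro continuous_intros \<sigma>c)
  then show "continuous_on ({0..1} \<times> UNIV) (\<lambda>(x, p). x * tilted_norm (\<sigma> j x) (lam j) p)"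
    by (simp add: tilted_norm_eq[OF \<sigma>(2) lam] case_prod_unfold)
  have "continuous_on ({0..1} \<times> UNIV) (\<lambda>z. fst z * ((snd z + lam j * \<sigma> j (fst z)) / sqrt ((snd z)\<^sup>2 + 2 * lam j * \<sigma> j (fst z) * snd z + (lam j)\<^sup>2)))"
    using tilted_norm_pos[OF \<sigma>(2) lam] by (intro continuous_intros \<sigma>c) (simp add: less_imp_neq[symmetric])
  moreover have "deriv (\<lambda>p. x * tilted_norm (\<sigma> j x) (lam j) p) p = x * ((p + lam j * \<sigma> j x) / sqrt (p\<^sup>2 + 2 * lam j * \<sigma> j x * p + (lam j)\<^sup>2))" for x p
    by (intro DERIV_imp_deriv DERIV_cmult DERIV_tilted_norm \<sigma> lam)
  ultimately show "continuous_on ({0..1} \<times> UNIV) (\<lambda>(x, p). deriv (\<lambda>p. x * tilted_norm (\<sigma> j x) (lam j) p) p)"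
    by (simp add: case_prod_unfold)
qed (auto intro: continuous_intros)

section \<open>The two weak equations when the value function is zero\<close>

lemma AE_weak_deriv_zero: "AE x in lebesgue_Omega. weak_deriv (\<lambda>_. 0) x = 0"
  using weak_deriv_AE_eq[OF smooth_has_weak_deriv[OF smooth_const[of 0]]] by simp

lemma weak_HJB_zero:
  assumes "\<And>x. x \<in> Omega \<Longrightarrow> H x 0 = 0"
  shows "weak_HJB \<nu> H (L2_functional (\<lambda>_. 0)) (\<lambda>_. 0)"
  unfolding weak_HJB_def
proof
  fix \<psi> :: "real \<Rightarrow> real"
  have "AE x in lebesgue_Omega. \<nu> * weak_deriv (\<lambda>_. 0) x * weak_deriv \<psi> x + H x (weak_deriv (\<lambda>_. 0) x) * \<psi> x = 0"
    using AE_weak_deriv_zero AE_space by eventually_elim (simp add: assms)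
  from LINT_cong_AE_Omega[OF borel_measurable_const this]
  show "(LINT x|lebesgue_Omega. \<nu> * weak_deriv (\<lambda>_. 0) x * weak_deriv \<psi> x + H x (weak_deriv (\<lambda>_. 0) x) * \<psi> x)
    = L2_functional (\<lambda>_. 0) \<psi>"
    by (simp add: L2_functional_def)
qed

text \<open>The first-order form of the equation: its integration constant is chosen so that the density
  \<open>x (1 - x) / (2 \<nu>)\<close> solves it with zero drift.\<close>

lemma weak_KFP_if_flux:
  assumes "smooth \<mu>" and flux: "AE x in lebesgue_Omega. \<nu> * deriv \<mu> x + \<mu> x * b x = 1/2 - x"
  shows "weak_KFP \<nu> b (L2_functional (\<lambda>_. 1)) \<mu>"
  unfolding weak_KFP_def
proof
  fix \<phi> assume \<phi>: "\<phi> \<in> H10"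
  let ?f = "\<lambda>x::real. 1/2 - x"
  have "smooth (\<lambda>x::real. 1/2 + (-1) * x)" by (intro smooth_intros)
  then have f: "smooth ?f" by simp
  have fd: "deriv ?f = (\<lambda>x. -1)" by (intro ext DERIV_imp_deriv) (auto intro!: derivative_eq_intros)
  have w: "weak_deriv \<phi> \<in> L2" using \<phi> by (intro H1_weak_deriv) (simp add: H10_def)
  have "AE x in lebesgue_Omega. \<nu> * weak_deriv \<mu> x * weak_deriv \<phi> x + \<mu> x * b x * weak_deriv \<phi> x = ?f x * weak_deriv \<phi> x"
    using weak_deriv_AE_eq[OF smooth_has_weak_deriv[OF assms(1)]] flux
    by eventually_elim (simp flip: distrib_right)
  from LINT_cong_AE_Omega[OF borel_measurable_integrable[OF L2_mult_integrable[OF smooth_L2[OF f] w]] this]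
  show "(LINT x|lebesgue_Omega. \<nu> * weak_deriv \<mu> x * weak_deriv \<phi> x + \<mu> x * b x * weak_deriv \<phi> x)
    = L2_functional (\<lambda>_. 1) \<phi>"
    by (simp add: H10_integral_by_parts[OF f \<phi>] fd L2_functional_def)
qed

theorem proposition8p1:
  fixes \<nu> :: real
    and F :: "(real \<Rightarrow> real) \<Rightarrow> (real \<Rightarrow> real) \<Rightarrow> real"
    and G :: "(real \<Rightarrow> real) \<Rightarrow> real"
  assumes "\<nu> > 0"
    and "F = (\<lambda>_. L2_functional (\<lambda>_. 0))"
    and "G = L2_functional (\<lambda>_. 1)"
  shows "\<exists>m \<in> H10. \<exists>(lam :: nat \<Rightarrow> real) Hreg u_reg m_reg.
     (\<forall>j. 0 < lam j \<and> lam j \<le> 1) \<and> lam \<longlonglongrightarrow> 0 \<and>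
     admissible_family mfg_H lam Hreg \<and>
     (\<forall>j. weak_solution_regularized \<nu> (Hreg j) F G (u_reg j) (m_reg j)) \<and>
     weak_solution_PDI \<nu> mfg_H F G (\<lambda>_. 0) m \<and>
     \<not> (AE x in lebesgue_Omega. m x = 0) \<and>
     weakly_converges_H10 m_reg m \<and>
     (\<exists>L > 0. (\<lambda>j. H1_norm (\<lambda>x. m_reg j x - m x)) \<longlonglongrightarrow> L)"
proof -
  define m where "m x = x * (1 - x) / (2 * \<nu>)" for x
  have "smooth (\<lambda>x. (1 / (2 * \<nu>)) * (x * (1 + (-1) * x)))" by (intro smooth_intros)
  then have ms: "smooth m" by (simp add: m_def [abs_def])
  have md: "\<nu> * deriv m x = 1/2 - x" for x
  proof -
    have "(m has_field_derivative (1 - 2 * x) / (2 * \<nu>)) (at x)"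
      unfolding m_def [abs_def] using \<open>\<nu> > 0\<close> by (auto intro!: derivative_eq_intros simp: field_simps)
    then show ?thesis using DERIV_imp_deriv \<open>\<nu> > 0\<close> by (fastforce simp: field_simps)
  qed
  have mpos: "0 < m x" if "x \<in> Omega" for x using that \<open>\<nu> > 0\<close> by (simp add: m_def)
  have mH: "m \<in> H10"
  proof (rule positive_smooth_H10[OF ms mpos])
    fix x :: real assume "x \<notin> Omega"
    then have "x * (1 - x) \<le> 0" by (auto simp: mult_le_0_iff)
    then show "m x \<le> 0" using \<open>\<nu> > 0\<close> by (simp add: m_def divide_le_0_iff)
  qed auto
  \<comment> \<open>The summand \<open>32 * \<nu>\<close> keeps \<open>w j\<close> below a third of
    the minimum \<open>3 / (32 * \<nu>)\<close> of \<open>m\<close> on \<open>{1/4..3/4}\<close>;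
    the summand \<open>128 * \<nu>\<^sup>2\<close> gives
    \<open>\<bar>\<sigma> j x\<bar> \<le> 1/2\<close>.\<close>
  define \<delta> where "\<delta> = 1 / (32 * \<nu> + 128 * \<nu>\<^sup>2)"
  have \<delta>: "0 < \<delta>" "\<delta> \<le> 1 / (32 * \<nu>)" "128 * \<nu>\<^sup>2 * \<delta> \<le> 1"
    using \<open>\<nu> > 0\<close> by (auto simp: \<delta>_def add_pos_pos intro!: divide_left_mono)
  obtain w L where w: "\<And>j. w j \<in> test_functions" "\<And>j x. w j x \<noteq> 0 \<Longrightarrow> x \<in> {1/4..3/4}"
    "\<And>j x. \<bar>w j x\<bar> \<le> \<delta> / real (Suc j)" "\<And>j x. \<bar>deriv (w j) x\<bar> \<le> \<delta>"
    "0 < L" "(\<lambda>j. H1_norm (w j)) \<longlonglongrightarrow> L"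
    by (rule oscillating_test_functions[OF \<delta>(1)], rule that)
  define \<mu> where "\<mu> j x = m x + w j x" for j x
  have \<mu>s: "smooth (\<mu> j)" for j
    unfolding \<mu>_def [abs_def] by (intro smooth_add ms test_function_smooth w)
  have \<mu>d: "deriv (\<mu> j) x = deriv m x + deriv (w j) x" for j x
    unfolding \<mu>_def [abs_def] by (simp add: deriv_add_smooth ms test_function_smooth w)
  have \<mu>H: "\<mu> j \<in> H10" for j
    unfolding \<mu>_def [abs_def] by (intro smooth_add_test_H10 mH ms w)
  \<comment> \<open>On \<open>{1/4..3/4}\<close> the perturbed density is at least
    \<open>2 / (32 * \<nu>) = 4 * c\<close>, and \<open>x \<ge> 1/4\<close>.\<close>
  define c where "c = 1 / (64 * \<nu>)"
  have c: "0 < c" using \<open>\<nu> > 0\<close> by (simp add: c_def)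
  have lower: "c \<le> x * \<mu> j x" if x: "x \<in> {1/4..3/4}" for x j
  proof -
    have "3 / 16 \<le> x * (1 - x)"
    proof -
      have "0 \<le> (x - 1/4) * (3/4 - x)" using x by (intro mult_nonneg_nonneg) auto
      also have "\<dots> = x * (1 - x) - 3 / 16" by (simp add: field_simps)
      finally show ?thesis by simp
    qed
    then have "3 / 16 / (2 * \<nu>) \<le> m x" unfolding m_def using \<open>\<nu> > 0\<close> by (intro divide_right_mono) auto
    moreover have "\<bar>w j x\<bar> \<le> 1 / (32 * \<nu>)"
    proof -
      have "\<delta> / real (Suc j) \<le> \<delta>" using \<delta>(1) by (simp add: field_simps)
      then show ?thesis using w(3)[of j x] \<delta>(2) by linarith
    qed
    ultimately have "3 / 16 / (2 * \<nu>) - 1 / (32 * \<nu>) \<le> \<mu> j x" unfolding \<mu>_def by linarith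
    moreover have "3 / 16 / (2 * \<nu>) - 1 / (32 * \<nu>) = 4 * c" by (simp add: c_def field_simps)
    ultimately have "4 * c \<le> \<mu> j x" by simp
    then have "(1/4) * (4 * c) \<le> x * \<mu> j x" using x c by (intro mult_mono) auto
    then show ?thesis by simp
  qed
  \<comment> \<open>This is the drift divided by \<open>x\<close>, because the Hamiltonian
    multiplies the tilted norm by \<open>x\<close>. The maximum makes \<open>\<sigma> j\<close>
    continuous on the whole line; it is inactive on \<open>{1/4..3/4}\<close>, and elsewhere the
    numerator vanishes.\<close>
  define \<sigma> where "\<sigma> j x = - \<nu> * deriv (w j) x / max c (x * \<mu> j x)" for j x
  have \<sigma>c: "continuous_on UNIV (\<sigma> j)" for j
    unfolding \<sigma>_def [abs_def] using c
    by (intro continuous_intros smooth_continuous \<mu>s smooth_deriv test_function_smooth w)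
      (auto simp: max_def)
  have \<sigma>b: "\<bar>\<sigma> j x\<bar> < 1" for j x
  proof -
    have "\<bar>\<sigma> j x\<bar> = \<nu> * \<bar>deriv (w j) x\<bar> / max c (x * \<mu> j x)"
      using \<open>\<nu> > 0\<close> c by (simp add: \<sigma>_def abs_mult)
    also have "\<dots> \<le> \<nu> * \<delta> / c"
      using \<open>\<nu> > 0\<close> c \<delta>(1) w(4)[of j x] by (intro frac_le mult_left_mono mult_nonneg_nonneg) auto
    also have "\<dots> = 64 * \<nu>\<^sup>2 * \<delta>" by (simp add: c_def power2_eq_square)
    also have "\<dots> < 1" using \<delta>(3) by linarith
    finally show ?thesis .
  qed
  have flux: "\<nu> * deriv (\<mu> j) x + \<mu> j x * (x * \<sigma> j x) = 1/2 - x" for j x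
  proof -
    have "\<mu> j x * (x * \<sigma> j x) = - \<nu> * deriv (w j) x"
    proof (cases "x \<in> {1/4..3/4}")
      case True
      then have "x * \<mu> j x \<noteq> 0" "max c (x * \<mu> j x) = x * \<mu> j x"
        using lower[OF True, of j] c by (auto simp: max_def)
      then show ?thesis by (auto simp: \<sigma>_def)
    next
      case False
      then show ?thesis using deriv_eq_0_outside[of "w j" "1/4" "3/4" x] w(2) by (simp add: \<sigma>_def)
    qed
    then show ?thesis using md[of x] by (simp add: \<mu>d distrib_left)
  qed
  \<comment> \<open>The slope at \<open>p = 0\<close> does not depend on the smoothing width, so any
    null sequence in \<open>(0, 1]\<close> would serve.\<close>
  define lam where "lam j = 1 / real (Suc j)" for j
  have lam: "0 < lam j" "lam j \<le> 1" for j by (simp_all add: lam_def)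
  define H where "H j x p = x * tilted_norm (\<sigma> j x) (lam j) p" for j x p
  have Hd: "deriv (H j x) 0 = x * \<sigma> j x" for j x
  proof -
    have "deriv (H j x) 0 = x * ((0 + lam j * \<sigma> j x) / sqrt (0\<^sup>2 + 2 * lam j * \<sigma> j x * 0 + (lam j)\<^sup>2))"
      unfolding H_def [abs_def] by (intro DERIV_imp_deriv DERIV_cmult DERIV_tilted_norm \<sigma>b lam)
    then show ?thesis using lam(1)[of j] by simp
  qed
  have reg: "weak_solution_regularized \<nu> (H j) F G (\<lambda>_. 0) (\<mu> j)" for j
    unfolding weak_solution_regularized_def assms(2,3)
  proof (intro conjI zero_H10 \<mu>H weak_HJB_zero weak_KFP_if_flux \<mu>s)
    show "H j x 0 = 0" for x by (simp add: H_def tilted_norm_0 \<sigma>b lam)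
    show "AE x in lebesgue_Omega. \<nu> * deriv (\<mu> j) x + \<mu> j x * deriv (H j x) (weak_deriv (\<lambda>_. 0) x) = 1/2 - x"
      using AE_weak_deriv_zero by eventually_elim (simp add: Hd flux)
  qed
  have PDI: "weak_solution_PDI \<nu> mfg_H F G (\<lambda>_. 0) m"
    unfolding weak_solution_PDI_def assms(2,3)
  proof (intro conjI zero_H10 mH bexI[of _ "\<lambda>_. 0"] weak_HJB_zero weak_KFP_if_flux ms)
    show "mfg_H x 0 = 0" if "x \<in> Omega" for x using that by (simp add: mfg_H_eq)
    show "AE x in lebesgue_Omega. \<nu> * deriv m x + m x * 0 = 1/2 - x" by (simp add: md)
    have "AE x in lebesgue_Omega. (0::real) \<in> subdiff_p mfg_H x (weak_deriv (\<lambda>_. 0) x)"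
      using AE_weak_deriv_zero AE_space by eventually_elim (simp add: subdiff_p_def mfg_H_eq)
    then show "(\<lambda>_. 0) \<in> DpH mfg_H (\<lambda>_. 0)"
      by (auto simp: DpH_def Linfty_def)
  qed
  have "\<not> (AE x in lebesgue_Omega. m x = 0)"
  proof
    assume "AE x in lebesgue_Omega. m x = 0"
    then have "AE x in lebesgue_Omega. False"
      using AE_space by eventually_elim (use mpos in force)
    then show False using emeasure_lebesgue_Omega by (simp add: eventually_False ae_filter_eq_bot_iff)
  qed
  moreover have "weakly_converges_H10 \<mu> m"
    unfolding weakly_converges_H10_def
  proof (intro allI impI)
    fix l assume l: "bounded_functional_H10 l"
    have "bounded (range (\<lambda>j. H1_norm (w j)))" by (rule convergent_imp_bounded[OF w(6)])
    then obtain C where "\<And>j. \<bar>H1_norm (w j)\<bar> \<le> C" by (auto simp: bounded_real)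
    then have C: "(H1_norm (w j))\<^sup>2 \<le> C\<^sup>2" for j by (simp add: abs_le_square_iff[symmetric] order_trans[OF _ abs_ge_self])
    have "(\<lambda>j. \<delta> / real (Suc j)) \<longlonglongrightarrow> 0" by real_asymp
    from bounded_functional_tendsto_0[OF l w(1) C w(3) this]
    have "(\<lambda>j. l m + l (w j)) \<longlonglongrightarrow> l m + 0" by (intro tendsto_intros)
    moreover have "l (\<mu> j) = l m + l (w j)" for j
      using l mH test_function_H10[OF w(1)] unfolding bounded_functional_H10_def \<mu>_def [abs_def] by blast
    ultimately show "(\<lambda>j. l (\<mu> j)) \<longlonglongrightarrow> l m" by simp
  qed
  moreover have "(\<lambda>j. H1_norm (\<lambda>x. \<mu> j x - m x)) \<longlonglongrightarrow> L"
    using w(6) by (simp add: \<mu>_def)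
  moreover have "lam \<longlonglongrightarrow> 0" unfolding lam_def [abs_def] by real_asymp
  moreover have "admissible_family mfg_H lam H"
    unfolding H_def [abs_def] by (intro admissible_tilted_family \<sigma>c \<sigma>b lam)
  ultimately show ?thesis
    using lam reg PDI w(5)
    by (intro bexI[OF _ mH] exI[of _ lam] exI[of _ H] exI[of _ "\<lambda>_ _. 0"] exI[of _ \<mu>]) auto
qed

end
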